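(* Let $b>a>0$, and let $B=(B_{t},\,t\geq 0)$ be a fractional Brownian motion with Hurst index $H\in(1/2,1)$. Then the random variable $Z=\sup_{[a,b]}B-E\big(\sup_{[a,b]}B\big)$ has a density $\rho$ satisfying, for almost all $z\in\mathbb{R}$, $$\frac{E|Z|}{2b^{2H}}\,\exp\left(-\frac{z^{2}}{2a^{2H}}\right)\leq\rho(z)\leq\frac{E|Z|}{2a^{2H}}\,\exp\left(-\frac{z^{2}}{2b^{2H}}\right).$$
   Context: A fractional Brownian motion with Hurst index $H\in(0,1)$ is a centered Gaussian process $B=(B_t)_{t\ge 0}$ with continuous paths and covariance $E(B_tB_s)=\frac12\big(t^{2H}+s^{2H}-|t-s|^{2H}\big)$. "Density" means density of the law with respect to Lebesgue measure on $\mathbb{R}$. *)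

theory Defs
  imports "HOL-Probability.Probability"
begin

(* Degenerate (almost surely constant) variables count as Gaussian. This is needed because
   linear combinations of a Gaussian process, such as B 0 = 0 for fractional Brownian motion,
   can have variance zero. *)
definition gaussian_variable :: "'a measure \<Rightarrow> ('a \<Rightarrow> real) \<Rightarrow> bool" where
  "gaussian_variable M X \<longleftrightarrow>
     X \<in> borel_measurable M \<and>
     ((\<exists>m. AE \<omega> in M. X \<omega> = m) \<or>
      (\<exists>m \<sigma>. 0 < \<sigma> \<and> distributed M lborel X (\<lambda>x. ennreal (normal_density m \<sigma> x))))"

(* The finite-dimensional laws are Gaussian exactly when every finite linear combination is. *)
definition gaussian_process :: "'a measure \<Rightarrow> 'i set \<Rightarrow> ('i \<Rightarrow> 'a \<Rightarrow> real) \<Rightarrow> bool" where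
  "gaussian_process M T X \<longleftrightarrow>
     prob_space M \<and>
     (\<forall>F c. finite F \<and> F \<subseteq> T \<longrightarrow> gaussian_variable M (\<lambda>\<omega>. \<Sum>t\<in>F. c t * X t \<omega>))"

definition centered_gaussian_process :: "'a measure \<Rightarrow> 'i set \<Rightarrow> ('i \<Rightarrow> 'a \<Rightarrow> real) \<Rightarrow> bool" where
  "centered_gaussian_process M T X \<longleftrightarrow>
     gaussian_process M T X \<and> (\<forall>t\<in>T. prob_space.expectation M (X t) = 0)"

(* Only the values B t with t \<ge> 0 matter. The base 0 is harmless: 0 powr (2 * H) = 0. *)
definition fractional_brownian_motion :: "'a measure \<Rightarrow> real \<Rightarrow> (real \<Rightarrow> 'a \<Rightarrow> real) \<Rightarrow> bool" where
  "fractional_brownian_motion M H B \<longleftrightarrow>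
     0 < H \<and> H < 1 \<and>
     centered_gaussian_process M {0..} B \<and>
     (\<forall>\<omega>\<in>space M. continuous_on {0..} (\<lambda>t. B t \<omega>)) \<and>
     (\<forall>t\<ge>0. \<forall>s\<ge>0. prob_space.expectation M (\<lambda>\<omega>. B t \<omega> * B s \<omega>) =
        (t powr (2 * H) + s powr (2 * H) - \<bar>t - s\<bar> powr (2 * H)) / 2)"

end

theory Submission
  imports Defs
begin

text \<open>
  Write \<open>\<alpha> = a\<^sup>2\<^sup>H\<close> and \<open>\<beta> = b\<^sup>2\<^sup>H\<close>. Since \<open>H > 1/2\<close>, all covariances of \<open>B\<close> on \<open>[a,b]\<close> lie in
  \<open>[\<alpha>,\<beta>]\<close>. For a finite centered Gaussian vector \<open>X\<close> with such covariances, an independent copy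
  \<open>X'\<close>, and a smooth maximum \<open>F\<close>, differentiate \<open>E F(X) \<phi>(F(cos s X + sin s X'))\<close> in \<open>s\<close>. Rotation
  invariance of \<open>(X, X')\<close> and, for each coordinate \<open>i\<close>, invariance of the law of \<open>X'\<close> under the
  reflection that flips \<open>X'\<^sub>i\<close> bound this derivative and give, for nondecreasing \<open>\<phi>\<close>,
  \<open>\<alpha> E \<phi>'(F) \<le> Cov(F, \<phi>(F)) \<le> \<beta> E \<phi>'(F)\<close>. The case \<open>\<phi> = id\<close> bounds the variance by \<open>\<beta>\<close>; as the
  supremum is finite, this already forces its expectation to be finite, and the inequality passes
  to the limit: \<open>\<alpha> E \<phi>'(Z) \<le> E Z \<phi>(Z) \<le> \<beta> E \<phi>'(Z)\<close>. With \<open>H(x) = E[Z; Z > x]\<close> the middle term is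
  the integral of \<open>\<phi>' H\<close>, so the law of \<open>Z\<close> has a density \<open>\<rho>\<close> with \<open>H/\<beta> \<le> \<rho> \<le> H/\<alpha>\<close>. Finally
  \<open>H' = - x \<rho>\<close> and \<open>H(0) = E|Z|/2\<close>, and a Gronwall argument bounds \<open>H\<close>.
\<close>

section \<open>Characteristic functions determine joint laws\<close>

text \<open>In Malliavin calculus, \<open>E Z \<phi>(Z) = E g(Z) \<phi>'(Z)\<close> for a suitable
  function \<open>g\<close>, and the density is \<open>E|Z| / (2 g(z))\<close> times the exponential
  of minus the integral of \<open>x / g(x)\<close> from \<open>0\<close> to \<open>z\<close>. For a
  supremum, \<open>g\<close> averages the covariance over pairs of random maximizers, so it stays in
  the range of the covariance, and the theorem can be read off. The proof keeps this mechanism but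
  works with symmetries of finite vectors. A smooth maximum is used because its gradient exists
  everywhere and is a probability vector: averages of covariances then stay in
  \<open>[\<alpha>, \<beta>]\<close>, however many points the grid has. Gaussian integration by
  parts would differentiate the factor \<open>F\<close>; the reflection puts a finite difference in
  place of that derivative, which monotonicity of \<open>F\<close> controls, also for singular
  covariance matrices. As this yields inequalities in place of the identity, they have to be
  multiplied by \<open>\<phi>'\<close> inside the expectation, and so \<open>\<phi>\<close> is taken
  nondecreasing.\<close>

text \<open>
  Normalized, the weights are probability densities, so Levy uniqueness applies to the reweighted laws.
\<close>

lemma weighted_char_unique_nonneg:
  fixes X :: "'a \<Rightarrow> real" and Y :: "'b \<Rightarrow> real" and V :: "'a \<Rightarrow> real" and W :: "'b \<Rightarrow> real"
  assumes [measurable]: "X \<in> borel_measurable M" "Y \<in> borel_measurable N"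
    and V: "integrable M V" "\<And>\<omega>. 0 \<le> V \<omega>" and W: "integrable N W" "\<And>\<omega>. 0 \<le> W \<omega>"
    and pos: "0 < (LINT \<omega>|M. V \<omega>)"
    and eq: "\<And>u. (CLINT \<omega>|M. iexp (u * X \<omega>) * V \<omega>) = (CLINT \<omega>|N. iexp (u * Y \<omega>) * W \<omega>)"
    and A: "A \<in> sets borel"
  shows "(LINT \<omega>|M. indicator A (X \<omega>) * V \<omega>) = (LINT \<omega>|N. indicator A (Y \<omega>) * W \<omega>)"
proof -
  have [measurable]: "V \<in> borel_measurable M" "W \<in> borel_measurable N"
    using V W by auto
  note A[measurable]
  define c where "c = (LINT \<omega>|M. V \<omega>)"
  have c: "0 < c" using pos by (simp add: c_def)
  have "complex_of_real (LINT \<omega>|M. V \<omega>) = complex_of_real (LINT \<omega>|N. W \<omega>)"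
    using eq[of 0] by simp
  then have cW: "(LINT \<omega>|N. W \<omega>) = c" by (simp add: c_def)
  define D where "D = density M (\<lambda>\<omega>. ennreal (V \<omega> / c))"
  define E where "E = density N (\<lambda>\<omega>. ennreal (W \<omega> / c))"
  have [measurable_cong]: "sets D = sets M" "sets E = sets N" by (simp_all add: D_def E_def)
  have "emeasure D (space D) = ennreal (LINT \<omega>|M. V \<omega> / c)"
    unfolding D_def using V c by (simp add: emeasure_density nn_integral_eq_integral cong: nn_integral_cong)
  also have "\<dots> = 1" using c by (simp add: c_def)
  finally interpret D: prob_space D by (rule prob_spaceI)
  have "emeasure E (space E) = ennreal (LINT \<omega>|N. W \<omega> / c)"
    unfolding E_def using W c by (simp add: emeasure_density nn_integral_eq_integral cong: nn_integral_cong)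
  also have "\<dots> = 1" using c cW by simp
  finally interpret E: prob_space E by (rule prob_spaceI)
  have "distr D borel X = distr E borel Y"
  proof (rule Levy_uniqueness)
    show "real_distribution (distr D borel X)" "real_distribution (distr E borel Y)"
      by (auto intro!: D.real_distribution_distr E.real_distribution_distr)
    show "char (distr D borel X) = char (distr E borel Y)"
    proof
      fix u
      have "char (distr D borel X) u = (CLINT \<omega>|M. (V \<omega> / c) *\<^sub>R iexp (u * X \<omega>))"
        unfolding char_def using V c
        by (subst integral_distr) (measurable, unfold D_def, intro integral_density, auto)
      also have "\<dots> = (CLINT \<omega>|M. iexp (u * X \<omega>) * V \<omega>) / c"
        by (simp add: scaleR_conv_of_real mult.commute)
      also have "\<dots> = (CLINT \<omega>|N. (W \<omega> / c) *\<^sub>R iexp (u * Y \<omega>))"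
        using eq[of u] by (simp add: scaleR_conv_of_real mult.commute)
      also have "\<dots> = char (distr E borel Y) u"
        unfolding char_def using W c
        by (subst integral_distr) (measurable, unfold E_def, intro integral_density[symmetric], auto)
      finally show "char (distr D borel X) u = char (distr E borel Y) u" .
    qed
  qed
  then have "(LINT x|distr D borel X. indicator A x) = (LINT x|distr E borel Y. indicator A x :: real)"
    by simp
  also have "(LINT x|distr D borel X. indicator A x) = (LINT \<omega>|M. (V \<omega> / c) *\<^sub>R (indicator A (X \<omega>) :: real))"
    using V c by (subst integral_distr) (measurable, unfold D_def, intro integral_density, auto)
  also have "(LINT x|distr E borel Y. indicator A x) = (LINT \<omega>|N. (W \<omega> / c) *\<^sub>R (indicator A (Y \<omega>) :: real))"
    using W c by (subst integral_distr) (measurable, unfold E_def, intro integral_density, auto)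
  finally show ?thesis using c by (simp add: mult.commute)
qed

text \<open>Adding 2 makes the weights positive, so the nonnegative case applies to
  \<open>2 + V\<close> and \<open>2 + W\<close>. By \<open>eq1\<close> it also applies to the
  constant weight 2, and subtracting the two identities leaves the claim.\<close>

lemma weighted_char_unique_real:
  fixes X :: "'a \<Rightarrow> real" and Y :: "'b \<Rightarrow> real" and V :: "'a \<Rightarrow> real" and W :: "'b \<Rightarrow> real"
  assumes "prob_space M" "prob_space N"
    and [measurable]: "X \<in> borel_measurable M" "Y \<in> borel_measurable N"
      "V \<in> borel_measurable M" "W \<in> borel_measurable N"
    and V: "\<And>\<omega>. \<bar>V \<omega>\<bar> \<le> 1" and W: "\<And>\<omega>. \<bar>W \<omega>\<bar> \<le> 1"
    and eq1: "\<And>u. (CLINT \<omega>|M. iexp (u * X \<omega>)) = (CLINT \<omega>|N. iexp (u * Y \<omega>))"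
    and eq: "\<And>u. (CLINT \<omega>|M. iexp (u * X \<omega>) * V \<omega>) = (CLINT \<omega>|N. iexp (u * Y \<omega>) * W \<omega>)"
    and [measurable]: "A \<in> sets borel"
  shows "(LINT \<omega>|M. indicator A (X \<omega>) * V \<omega>) = (LINT \<omega>|N. indicator A (Y \<omega>) * W \<omega>)"
proof -
  interpret M: prob_space M by fact
  interpret N: prob_space N by fact
  have iV: "integrable M V" using V by (intro M.integrable_const_bound[where B=1]) auto
  have iW: "integrable N W" using W by (intro N.integrable_const_bound[where B=1]) auto
  have iVA: "integrable M (\<lambda>\<omega>. indicator A (X \<omega>) * V \<omega>)"
    using V by (intro M.integrable_const_bound[where B=1]) (auto simp: indicator_def)
  have iWA: "integrable N (\<lambda>\<omega>. indicator A (Y \<omega>) * W \<omega>)"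
    using W by (intro N.integrable_const_bound[where B=1]) (auto simp: indicator_def)
  have iM: "integrable M (\<lambda>\<omega>. indicator A (X \<omega>) * 2 :: real)"
    by (intro M.integrable_const_bound[where B=2]) (auto simp: indicator_def)
  have iN: "integrable N (\<lambda>\<omega>. indicator A (Y \<omega>) * 2 :: real)"
    by (intro N.integrable_const_bound[where B=2]) (auto simp: indicator_def)
  have iXV: "integrable M (\<lambda>\<omega>. iexp (u * X \<omega>) * V \<omega>)" for u
    using V by (intro M.integrable_const_bound[where B=1]) (auto simp: norm_mult)
  have iYW: "integrable N (\<lambda>\<omega>. iexp (u * Y \<omega>) * W \<omega>)" for u
    using W by (intro N.integrable_const_bound[where B=1]) (auto simp: norm_mult)
  have iX: "integrable M (\<lambda>\<omega>. iexp (u * X \<omega>) * 2)" for u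
    by (intro M.integrable_const_bound[where B=2]) (auto simp: norm_mult)
  have iY: "integrable N (\<lambda>\<omega>. iexp (u * Y \<omega>) * 2)" for u
    by (intro N.integrable_const_bound[where B=2]) (auto simp: norm_mult)
  have 2: "(LINT \<omega>|M. indicator A (X \<omega>) * 2) = (LINT \<omega>|N. indicator A (Y \<omega>) * (2::real))"
    using eq1 by (intro weighted_char_unique_nonneg) (auto simp: M.prob_space)
  have V': "0 \<le> 2 + V \<omega>" for \<omega> using V[of \<omega>] by linarith
  have W': "0 \<le> 2 + W \<omega>" for \<omega> using W[of \<omega>] by linarith
  have "(LINT \<omega>|M. (1::real)) \<le> (LINT \<omega>|M. 2 + V \<omega>)"
  proof (rule integral_mono)
    show "1 \<le> 2 + V \<omega>" for \<omega> using V[of \<omega>] by linarith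
  qed (use iV in auto)
  then have pos: "0 < (LINT \<omega>|M. 2 + V \<omega>)" by (simp only: lebesgue_integral_const M.prob_space) simp
  have "(LINT \<omega>|M. indicator A (X \<omega>) * (2 + V \<omega>)) = (LINT \<omega>|N. indicator A (Y \<omega>) * (2 + W \<omega>))"
  proof (rule weighted_char_unique_nonneg)
    fix u
    have "(CLINT \<omega>|M. iexp (u * X \<omega>) * (2 + V \<omega>)) = (CLINT \<omega>|M. iexp (u * X \<omega>) * 2) + (CLINT \<omega>|M. iexp (u * X \<omega>) * V \<omega>)"
      by (subst Bochner_Integration.integral_add[symmetric, OF iX iXV]) (simp add: distrib_left)
    also have "\<dots> = (CLINT \<omega>|N. iexp (u * Y \<omega>) * 2) + (CLINT \<omega>|N. iexp (u * Y \<omega>) * W \<omega>)"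
      using eq1 eq by simp
    also have "\<dots> = (CLINT \<omega>|N. iexp (u * Y \<omega>) * (2 + W \<omega>))"
      by (subst Bochner_Integration.integral_add[symmetric, OF iY iYW]) (simp add: distrib_left)
    finally show "(CLINT \<omega>|M. iexp (u * X \<omega>) * complex_of_real (2 + V \<omega>)) =
       (CLINT \<omega>|N. iexp (u * Y \<omega>) * complex_of_real (2 + W \<omega>))" by simp
  qed (use iV iW V' W' pos in auto)
  moreover have "(LINT \<omega>|M. indicator A (X \<omega>) * (2 + V \<omega>)) =
      (LINT \<omega>|M. indicator A (X \<omega>) * 2) + (LINT \<omega>|M. indicator A (X \<omega>) * V \<omega>)"
    by (subst Bochner_Integration.integral_add[symmetric, OF iM iVA]) (simp add: distrib_left)
  moreover have "(LINT \<omega>|N. indicator A (Y \<omega>) * (2 + W \<omega>)) =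
      (LINT \<omega>|N. indicator A (Y \<omega>) * 2) + (LINT \<omega>|N. indicator A (Y \<omega>) * W \<omega>)"
    by (subst Bochner_Integration.integral_add[symmetric, OF iN iWA]) (simp add: distrib_left)
  ultimately show ?thesis using 2 by simp
qed

text \<open>Real and imaginary parts are combinations of \<open>V\<close> and \<open>cnj V\<close>,
  so the real case applies to each of them. The hypothesis for \<open>cnj V\<close> at
  \<open>u\<close> is the conjugate of the one for \<open>V\<close> at \<open>- u\<close>.\<close>

lemma weighted_char_unique:
  fixes X :: "'a \<Rightarrow> real" and Y :: "'b \<Rightarrow> real" and V :: "'a \<Rightarrow> complex" and W :: "'b \<Rightarrow> complex"
  assumes M: "prob_space M" and N: "prob_space N"
    and [measurable]: "X \<in> borel_measurable M" "Y \<in> borel_measurable N"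
      "V \<in> borel_measurable M" "W \<in> borel_measurable N"
    and V: "\<And>\<omega>. norm (V \<omega>) \<le> 1" and W: "\<And>\<omega>. norm (W \<omega>) \<le> 1"
    and eq1: "\<And>u. (CLINT \<omega>|M. iexp (u * X \<omega>)) = (CLINT \<omega>|N. iexp (u * Y \<omega>))"
    and eq: "\<And>u. (CLINT \<omega>|M. iexp (u * X \<omega>) * V \<omega>) = (CLINT \<omega>|N. iexp (u * Y \<omega>) * W \<omega>)"
    and [measurable]: "A \<in> sets borel"
  shows "(CLINT \<omega>|M. indicator A (X \<omega>) * V \<omega>) = (CLINT \<omega>|N. indicator A (Y \<omega>) * W \<omega>)"
proof -
  interpret M: prob_space M by fact
  interpret N: prob_space N by fact
  have iV: "integrable M (\<lambda>\<omega>. indicator A (X \<omega>) * V \<omega>)"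
    using V by (intro M.integrable_const_bound[where B=1]) (auto simp: norm_mult indicator_def)
  have iW: "integrable N (\<lambda>\<omega>. indicator A (Y \<omega>) * W \<omega>)"
    using W by (intro N.integrable_const_bound[where B=1]) (auto simp: norm_mult indicator_def)
  have iXV: "integrable M (\<lambda>\<omega>. iexp (u * X \<omega>) * V \<omega>)" for u
    using V by (intro M.integrable_const_bound[where B=1]) (auto simp: norm_mult)
  have iYW: "integrable N (\<lambda>\<omega>. iexp (u * Y \<omega>) * W \<omega>)" for u
    using W by (intro N.integrable_const_bound[where B=1]) (auto simp: norm_mult)
  have [measurable]: "(\<lambda>\<omega>. cnj (V \<omega>)) \<in> borel_measurable M" "(\<lambda>\<omega>. cnj (W \<omega>)) \<in> borel_measurable N"
    by (intro borel_measurable_continuous_on[where f = cnj] continuous_intros; fact)+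
  have iXV': "integrable M (\<lambda>\<omega>. iexp (u * X \<omega>) * cnj (V \<omega>))" for u
    using V by (intro M.integrable_const_bound[where B=1]) (auto simp: norm_mult)
  have iYW': "integrable N (\<lambda>\<omega>. iexp (u * Y \<omega>) * cnj (W \<omega>))" for u
    using W by (intro N.integrable_const_bound[where B=1]) (auto simp: norm_mult)
  have cnj_eq: "(CLINT \<omega>|M. iexp (u * X \<omega>) * cnj (V \<omega>)) = (CLINT \<omega>|N. iexp (u * Y \<omega>) * cnj (W \<omega>))" for u
  proof -
    have "cnj (CLINT \<omega>|M. iexp (- u * X \<omega>) * V \<omega>) = cnj (CLINT \<omega>|N. iexp (- u * Y \<omega>) * W \<omega>)"
      by (simp only: eq)
    then show ?thesis unfolding Bochner_Integration.integral_cnj[symmetric] by (simp add: exp_cnj)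
  qed
  have Re: "(LINT \<omega>|M. indicator A (X \<omega>) * Re (V \<omega>)) = (LINT \<omega>|N. indicator A (Y \<omega>) * Re (W \<omega>))"
  proof (rule weighted_char_unique_real[OF M N])
    fix u
    have "(CLINT \<omega>|M. iexp (u * X \<omega>) * Re (V \<omega>)) =
      (CLINT \<omega>|M. (iexp (u * X \<omega>) * V \<omega> + iexp (u * X \<omega>) * cnj (V \<omega>)) / 2)"
      by (intro Bochner_Integration.integral_cong refl) (simp add: distrib_left[symmetric] complex_add_cnj)
    also have "\<dots> = (CLINT \<omega>|N. (iexp (u * Y \<omega>) * W \<omega> + iexp (u * Y \<omega>) * cnj (W \<omega>)) / 2)"
      by (simp only: integral_divide_zero Bochner_Integration.integral_add[OF iXV iXV'] Bochner_Integration.integral_add[OF iYW iYW'] eq cnj_eq)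
    also have "\<dots> = (CLINT \<omega>|N. iexp (u * Y \<omega>) * Re (W \<omega>))"
      by (intro Bochner_Integration.integral_cong refl) (simp add: distrib_left[symmetric] complex_add_cnj)
    finally show "(CLINT \<omega>|M. iexp (u * X \<omega>) * complex_of_real (Re (V \<omega>))) =
       (CLINT \<omega>|N. iexp (u * Y \<omega>) * complex_of_real (Re (W \<omega>)))" .
    show "(CLINT \<omega>|M. iexp (u * X \<omega>)) = (CLINT \<omega>|N. iexp (u * Y \<omega>))" by (rule eq1)
    show "\<bar>Re (V \<omega>)\<bar> \<le> 1" for \<omega> by (rule order_trans[OF abs_Re_le_cmod V])
    show "\<bar>Re (W \<omega>)\<bar> \<le> 1" for \<omega> by (rule order_trans[OF abs_Re_le_cmod W])
  qed measurable
  have Im: "(LINT \<omega>|M. indicator A (X \<omega>) * Im (V \<omega>)) = (LINT \<omega>|N. indicator A (Y \<omega>) * Im (W \<omega>))"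
  proof (rule weighted_char_unique_real[OF M N])
    fix u
    have *: "z * Im v = (z * v - z * cnj v) / (2 * \<i>)" for z v :: complex
    proof -
      have eq: "(z * Im v) * (2 * \<i>) = z * v - z * cnj v" by (simp add: complex_eq_iff algebra_simps)
      have "2 * \<i> \<noteq> 0" by simp
      from nonzero_eq_divide_eq[OF this, THEN iffD2, OF eq] show ?thesis .
    qed
    have "(CLINT \<omega>|M. iexp (u * X \<omega>) * Im (V \<omega>)) =
      (CLINT \<omega>|M. (iexp (u * X \<omega>) * V \<omega> - iexp (u * X \<omega>) * cnj (V \<omega>)) / (2 * \<i>))"
      by (simp only: *)
    also have "\<dots> = (CLINT \<omega>|N. (iexp (u * Y \<omega>) * W \<omega> - iexp (u * Y \<omega>) * cnj (W \<omega>)) / (2 * \<i>))"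
      by (simp only: integral_divide_zero Bochner_Integration.integral_diff[OF iXV iXV'] Bochner_Integration.integral_diff[OF iYW iYW'] eq cnj_eq)
    also have "\<dots> = (CLINT \<omega>|N. iexp (u * Y \<omega>) * Im (W \<omega>))"
      by (simp only: *)
    finally show "(CLINT \<omega>|M. iexp (u * X \<omega>) * complex_of_real (Im (V \<omega>))) =
       (CLINT \<omega>|N. iexp (u * Y \<omega>) * complex_of_real (Im (W \<omega>)))" .
    show "(CLINT \<omega>|M. iexp (u * X \<omega>)) = (CLINT \<omega>|N. iexp (u * Y \<omega>))" by (rule eq1)
    show "\<bar>Im (V \<omega>)\<bar> \<le> 1" for \<omega> by (rule order_trans[OF abs_Im_le_cmod V])
    show "\<bar>Im (W \<omega>)\<bar> \<le> 1" for \<omega> by (rule order_trans[OF abs_Im_le_cmod W])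
  qed measurable
  have ind: "Re (indicator A x :: complex) = indicator A x" "Im (indicator A x :: complex) = 0" for x :: real
    by (auto simp: indicator_def)
  show ?thesis
    using Re Im iV iW by (intro complex_eqI) (simp_all flip: integral_Re integral_Im add: ind)
qed

text \<open>
  The coordinates in \<open>K\<close> have already been converted, one at a time, from exponentials into indicator
  functions; the remaining factors play the role of the weight in \<open>weighted_char_unique\<close>.
\<close>

lemma char_family_unique_boxes:
  fixes X :: "'k \<Rightarrow> 'a \<Rightarrow> real" and Y :: "'k \<Rightarrow> 'b \<Rightarrow> real"
  assumes M: "prob_space M" and N: "prob_space N" and J: "finite J"
    and X[measurable]: "\<And>j. j \<in> J \<Longrightarrow> X j \<in> borel_measurable M"
    and Y[measurable]: "\<And>j. j \<in> J \<Longrightarrow> Y j \<in> borel_measurable N"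
    and eq: "\<And>c. (CLINT \<omega>|M. iexp (\<Sum>j\<in>J. c j * X j \<omega>)) = (CLINT \<omega>|N. iexp (\<Sum>j\<in>J. c j * Y j \<omega>))"
    and K: "finite K" "K \<subseteq> J" and A: "\<And>j. j \<in> K \<Longrightarrow> A j \<in> sets borel"
  shows "(CLINT \<omega>|M. (\<Prod>j\<in>K. indicator (A j) (X j \<omega>)) * iexp (\<Sum>j\<in>J - K. c j * X j \<omega>)) =
         (CLINT \<omega>|N. (\<Prod>j\<in>K. indicator (A j) (Y j \<omega>)) * iexp (\<Sum>j\<in>J - K. c j * Y j \<omega>))"
  using K A
proof (induction K arbitrary: c rule: finite_induct)
  case empty
  then show ?case using eq by simp
next
  case (insert k K)
  have k: "k \<in> J" "k \<notin> K" and J': "J - K = insert k (J - insert k K)" "k \<notin> J - insert k K"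
    using insert by auto
  have [measurable]: "A j \<in> sets borel" if "j \<in> K" for j using insert that by auto
  have [measurable]: "X j \<in> borel_measurable M" "Y j \<in> borel_measurable N" if "j \<in> J - insert k K" for j
    using that by auto
  have [measurable]: "X j \<in> borel_measurable M" "Y j \<in> borel_measurable N" if "j \<in> K" for j
    using that insert.prems(1) by auto
  have [simp]: "norm (\<Prod>j\<in>K. indicator (A j) (Z j) :: complex) \<le> 1" for Z :: "'k \<Rightarrow> real"
    by (auto simp: prod_norm[symmetric] indicator_def intro!: prod_le_1)
  have "(CLINT \<omega>|M. indicator (A k) (X k \<omega>) * ((\<Prod>j\<in>K. indicator (A j) (X j \<omega>)) * iexp (\<Sum>j\<in>J - insert k K. c j * X j \<omega>))) =
        (CLINT \<omega>|N. indicator (A k) (Y k \<omega>) * ((\<Prod>j\<in>K. indicator (A j) (Y j \<omega>)) * iexp (\<Sum>j\<in>J - insert k K. c j * Y j \<omega>)))"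
  proof (rule weighted_char_unique[OF M N])
    show "X k \<in> borel_measurable M" "Y k \<in> borel_measurable N" using X Y k by auto
    show "(\<lambda>\<omega>. (\<Prod>j\<in>K. indicator (A j) (X j \<omega>)) * iexp (\<Sum>j\<in>J - insert k K. c j * X j \<omega>)) \<in> borel_measurable M"
      "(\<lambda>\<omega>. (\<Prod>j\<in>K. indicator (A j) (Y j \<omega>)) * iexp (\<Sum>j\<in>J - insert k K. c j * Y j \<omega>)) \<in> borel_measurable N"
      by measurable
    show "A k \<in> sets borel" using insert by auto
    fix u
    have s: "(\<Sum>j\<in>J. (if j = k then u else 0) * X j \<omega>) = u * X k \<omega>" "(\<Sum>j\<in>J. (if j = k then u else 0) * Y j \<omega>') = u * Y k \<omega>'" for \<omega> \<omega>'
      using k J by (simp_all add: if_distrib[of "\<lambda>x. x * _"] sum.delta cong: if_cong)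
    show "(CLINT \<omega>|M. iexp (u * X k \<omega>)) = (CLINT \<omega>|N. iexp (u * Y k \<omega>))"
      using eq[of "\<lambda>j. if j = k then u else 0"] by (simp only: s)
    \<comment> \<open>The induction hypothesis holds for all coefficients. Giving \<open>k\<close>
      the coefficient \<open>u\<close> splits off exactly the exponential that
      \<open>weighted_char_unique\<close> inverts.\<close>
    have s': "iexp (\<Sum>j\<in>J - K. (c(k := u)) j * Z j) = iexp (u * Z k) * iexp (\<Sum>j\<in>J - insert k K. c j * Z j)" for Z :: "'k \<Rightarrow> real"
    proof -
      have "(\<Sum>j\<in>J - insert k K. (c(k := u)) j * Z j) = (\<Sum>j\<in>J - insert k K. c j * Z j)"
        by (intro sum.cong) auto
      then have "(\<Sum>j\<in>J - K. (c(k := u)) j * Z j) = u * Z k + (\<Sum>j\<in>J - insert k K. c j * Z j)"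
        using J J'(2) by (subst J'(1)) simp
      then show ?thesis by (simp only: exp_add distrib_left of_real_add)
    qed
    show "(CLINT \<omega>|M. iexp (u * X k \<omega>) * ((\<Prod>j\<in>K. indicator (A j) (X j \<omega>)) * iexp (\<Sum>j\<in>J - insert k K. c j * X j \<omega>))) =
      (CLINT \<omega>|N. iexp (u * Y k \<omega>) * ((\<Prod>j\<in>K. indicator (A j) (Y j \<omega>)) * iexp (\<Sum>j\<in>J - insert k K. c j * Y j \<omega>)))"
      using insert.IH[of "c(k := u)"] insert.prems unfolding s' by (simp add: mult_ac)
  qed (simp_all add: norm_mult)
  then show ?case using insert.hyps by (simp add: mult.assoc)
qed

text \<open>With \<open>K = J\<close> no exponential is left in
  \<open>char_family_unique_boxes\<close>, so the two laws agree on boxes, which generate the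
  product sigma-algebra and are closed under intersection.\<close>

theorem char_family_unique:
  fixes X :: "'k \<Rightarrow> 'a \<Rightarrow> real" and Y :: "'k \<Rightarrow> 'b \<Rightarrow> real"
  assumes M: "prob_space M" and N: "prob_space N" and J: "finite J"
    and X: "\<And>j. j \<in> J \<Longrightarrow> X j \<in> borel_measurable M"
    and Y: "\<And>j. j \<in> J \<Longrightarrow> Y j \<in> borel_measurable N"
    and eq: "\<And>c. (CLINT \<omega>|M. iexp (\<Sum>j\<in>J. c j * X j \<omega>)) = (CLINT \<omega>|N. iexp (\<Sum>j\<in>J. c j * Y j \<omega>))"
  shows "distr M (\<Pi>\<^sub>M j\<in>J. borel) (\<lambda>\<omega>. \<lambda>j\<in>J. X j \<omega>) = distr N (\<Pi>\<^sub>M j\<in>J. borel) (\<lambda>\<omega>. \<lambda>j\<in>J. Y j \<omega>)"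
proof -
  interpret M: prob_space M by fact
  interpret N: prob_space N by fact
  have [measurable]: "(\<lambda>\<omega>. \<lambda>j\<in>J. X j \<omega>) \<in> measurable M (\<Pi>\<^sub>M j\<in>J. borel)"
     "(\<lambda>\<omega>. \<lambda>j\<in>J. Y j \<omega>) \<in> measurable N (\<Pi>\<^sub>M j\<in>J. borel)"
    by (intro measurable_restrict X Y; assumption)+
  interpret DM: prob_space "distr M (\<Pi>\<^sub>M j\<in>J. borel) (\<lambda>\<omega>. \<lambda>j\<in>J. X j \<omega>)"
    by (rule M.prob_space_distr) measurable
  have box: "(\<lambda>\<omega>. \<lambda>j\<in>J. Z j \<omega>) -` Pi\<^sub>E J A \<inter> space L = {\<omega>\<in>space L. \<forall>j\<in>J. Z j \<omega> \<in> A j}" for Z :: "'k \<Rightarrow> 'c \<Rightarrow> real" and A L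
    by (auto simp: PiE_iff)
  have prod: "(CLINT \<omega>|L. (\<Prod>j\<in>J. indicator (A j) (Z j \<omega>))) = complex_of_real (measure L {\<omega>\<in>space L. \<forall>j\<in>J. Z j \<omega> \<in> A j})"
    if "prob_space L" "\<And>j. j \<in> J \<Longrightarrow> A j \<in> sets borel" "\<And>j. j \<in> J \<Longrightarrow> Z j \<in> borel_measurable L" for L :: "'c measure" and A and Z :: "'k \<Rightarrow> 'c \<Rightarrow> real"
  proof -
    interpret L: prob_space L by fact
    have [measurable]: "{\<omega>\<in>space L. \<forall>j\<in>J. Z j \<omega> \<in> A j} \<in> sets L" 
    proof (rule sets.sets_Collect_finite_All[OF _ J])
      show "{\<omega>\<in>space L. Z j \<omega> \<in> A j} \<in> sets L" if "j \<in> J" for j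
        using measurable_sets[OF \<open>\<And>j. j \<in> J \<Longrightarrow> Z j \<in> borel_measurable L\<close> \<open>\<And>j. j \<in> J \<Longrightarrow> A j \<in> sets borel\<close>, OF that that]
        by (simp add: vimage_def Int_def conj_commute)
    qed
    have "(CLINT \<omega>|L. (\<Prod>j\<in>J. indicator (A j) (Z j \<omega>))) = (CLINT \<omega>|L. complex_of_real (indicator {\<omega>\<in>space L. \<forall>j\<in>J. Z j \<omega> \<in> A j} \<omega>))"
      using J by (intro Bochner_Integration.integral_cong refl) (auto simp: indicator_def)
    then show ?thesis by simp
  qed
  show ?thesis
  proof (rule measure_eqI_PiM_finite[OF J])
    fix A :: "'k \<Rightarrow> real set" assume A: "\<And>j. j \<in> J \<Longrightarrow> A j \<in> sets borel"
    have P: "Pi\<^sub>E J A \<in> sets (\<Pi>\<^sub>M j\<in>J. borel)" using A J by (intro sets_PiM_I_finite) auto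
    have "complex_of_real (measure M {\<omega>\<in>space M. \<forall>j\<in>J. X j \<omega> \<in> A j}) = (CLINT \<omega>|M. (\<Prod>j\<in>J. indicator (A j) (X j \<omega>)))"
      by (rule prod[symmetric, OF M A X])
    also have "\<dots> = (CLINT \<omega>|N. (\<Prod>j\<in>J. indicator (A j) (Y j \<omega>)))"
      using char_family_unique_boxes[OF M N J X Y eq J subset_refl A, where c = "\<lambda>_. 0"]
      by (simp only: Diff_cancel sum.empty of_real_0 mult_zero_right exp_zero mult_1_right)
    also have "\<dots> = complex_of_real (measure N {\<omega>\<in>space N. \<forall>j\<in>J. Y j \<omega> \<in> A j})"
      by (rule prod[OF N A Y])
    finally have "complex_of_real (measure M {\<omega>\<in>space M. \<forall>j\<in>J. X j \<omega> \<in> A j}) = complex_of_real (measure N {\<omega>\<in>space N. \<forall>j\<in>J. Y j \<omega> \<in> A j})" .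
    then have "measure M {\<omega>\<in>space M. \<forall>j\<in>J. X j \<omega> \<in> A j} = measure N {\<omega>\<in>space N. \<forall>j\<in>J. Y j \<omega> \<in> A j}" by simp
    then show "emeasure (distr M (\<Pi>\<^sub>M j\<in>J. borel) (\<lambda>\<omega>. \<lambda>j\<in>J. X j \<omega>)) (Pi\<^sub>E J A) =
        emeasure (distr N (\<Pi>\<^sub>M j\<in>J. borel) (\<lambda>\<omega>. \<lambda>j\<in>J. Y j \<omega>)) (Pi\<^sub>E J A)"
      by (simp add: emeasure_distr[OF _ P] box M.emeasure_eq_measure N.emeasure_eq_measure)
  next
    show "range (\<lambda>i::nat. \<Pi>\<^sub>E j\<in>J. UNIV :: real set) \<subseteq> prod_algebra J (\<lambda>j. borel)"
      using J by (auto intro!: prod_algebraI_finite)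
    show "(\<Union>i::nat. \<Pi>\<^sub>E j\<in>J. UNIV :: real set) = space (\<Pi>\<^sub>M j\<in>J. borel)" by (simp add: space_PiM)
  qed (auto)
qed

section \<open>Integrability of products and squares\<close>

lemma (in pair_sigma_finite)
  fixes f :: "'a \<Rightarrow> real" and g :: "'b \<Rightarrow> real"
  assumes f: "integrable M1 f" and g: "integrable M2 g"
  shows integrable_mult_pair: "integrable (M1 \<Otimes>\<^sub>M M2) (\<lambda>x. f (fst x) * g (snd x))"
    and integral_mult_pair: "(LINT x|(M1 \<Otimes>\<^sub>M M2). f (fst x) * g (snd x)) = (LINT x|M1. f x) * (LINT y|M2. g y)"
proof -
  have [measurable]: "f \<in> borel_measurable M1" "g \<in> borel_measurable M2" using assms by auto
  show 1: "integrable (M1 \<Otimes>\<^sub>M M2) (\<lambda>x. f (fst x) * g (snd x))"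
  proof (rule Fubini_integrable)
    show "integrable M1 (\<lambda>x. LINT y|M2. norm (f (fst (x, y)) * g (snd (x, y))))"
      using f by (simp add: abs_mult)
    show "AE x in M1. integrable M2 (\<lambda>y. f (fst (x, y)) * g (snd (x, y)))"
      using g by simp
  qed measurable
  show "(LINT x|(M1 \<Otimes>\<^sub>M M2). f (fst x) * g (snd x)) = (LINT x|M1. f x) * (LINT y|M2. g y)"
    using integral_fst'[OF 1] by simp
qed

lemma integrable_mult_of_squares:
  fixes f g :: "'a \<Rightarrow> real"
  assumes [measurable]: "f \<in> borel_measurable M" "g \<in> borel_measurable M"
    and "integrable M (\<lambda>x. (f x)\<^sup>2)" "integrable M (\<lambda>x. (g x)\<^sup>2)"
  shows "integrable M (\<lambda>x. f x * g x)"
proof (rule Bochner_Integration.integrable_bound)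
  show "integrable M (\<lambda>x. (f x)\<^sup>2 + (g x)\<^sup>2)" using assms by simp
  have "\<bar>a * b\<bar> \<le> a\<^sup>2 + b\<^sup>2" for a b :: real
  proof -
    have "2 * \<bar>a\<bar> * \<bar>b\<bar> \<le> \<bar>a\<bar>\<^sup>2 + \<bar>b\<bar>\<^sup>2" by (rule sum_squares_bound)
    moreover have "0 \<le> \<bar>a\<bar> * \<bar>b\<bar>" by simp
    ultimately show ?thesis unfolding abs_mult power2_abs by linarith
  qed
  then show "AE x in M. norm (f x * g x) \<le> norm ((f x)\<^sup>2 + (g x)\<^sup>2)" by simp
qed measurable

lemma integrable_add_square:
  fixes f g :: "'a \<Rightarrow> real"
  assumes [measurable]: "f \<in> borel_measurable M" "g \<in> borel_measurable M"
    and "integrable M (\<lambda>x. (f x)\<^sup>2)" "integrable M (\<lambda>x. (g x)\<^sup>2)"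
  shows "integrable M (\<lambda>x. (f x + g x)\<^sup>2)"
  using assms integrable_mult_of_squares[OF assms] by (simp add: power2_sum mult.assoc)

lemma integrable_square_bound:
  fixes f g :: "'a \<Rightarrow> real"
  assumes "integrable M (\<lambda>x. (g x)\<^sup>2)" "f \<in> borel_measurable M" "\<And>x. \<bar>f x\<bar> \<le> g x"
  shows "integrable M (\<lambda>x. (f x)\<^sup>2)"
proof (rule Bochner_Integration.integrable_bound[OF assms(1)])
  show "(\<lambda>x. (f x)\<^sup>2) \<in> borel_measurable M" using assms(2) by measurable
  have "(f x)\<^sup>2 \<le> (g x)\<^sup>2" for x
    using power_mono[OF assms(3)[of x], of 2] by simp
  then show "AE x in M. norm ((f x)\<^sup>2) \<le> norm ((g x)\<^sup>2)" by simp
qed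

lemma integrable_sum_square:
  fixes f :: "'i \<Rightarrow> 'a \<Rightarrow> real"
  assumes "\<And>i. i \<in> I \<Longrightarrow> f i \<in> borel_measurable M" "\<And>i. i \<in> I \<Longrightarrow> integrable M (\<lambda>x. (f i x)\<^sup>2)"
  shows "integrable M (\<lambda>x. (\<Sum>i\<in>I. f i x)\<^sup>2)"
  using assms
proof (induction I rule: infinite_finite_induct)
  case (insert j J)
  have "integrable M (\<lambda>\<omega>. (f j \<omega> + (\<Sum>i\<in>J. f i \<omega>))\<^sup>2)"
    using insert by (intro integrable_add_square borel_measurable_sum) auto
  then show ?case using insert by simp
qed auto

text \<open>Testing with the set where \<open>g < f\<close> forces a nonnegative function with
  integral zero to vanish almost everywhere.\<close>

lemma AE_le_of_integral_le:
  fixes f g :: "'a \<Rightarrow> real"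
  assumes f: "integrable M f" and g: "integrable M g"
    and le: "\<And>A. A \<in> sets M \<Longrightarrow> (LINT x|M. f x * indicator A x) \<le> (LINT x|M. g x * indicator A x)"
  shows "AE x in M. f x \<le> g x"
proof -
  have [measurable]: "f \<in> borel_measurable M" "g \<in> borel_measurable M" using f g by auto
  define A where "A = {x\<in>space M. g x < f x}"
  have [measurable]: "A \<in> sets M" unfolding A_def by measurable
  have i: "integrable M (\<lambda>x. f x * indicator A x)" "integrable M (\<lambda>x. g x * indicator A x)"
    using f g by (auto intro!: integrable_real_mult_indicator)
  have nn: "AE x in M. 0 \<le> f x * indicator A x - g x * indicator A x"
    by (auto simp: indicator_def A_def)
  have "(LINT x|M. f x * indicator A x - g x * indicator A x) = 0"
    using le[of A] integral_nonneg_AE[OF nn] i by simp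
  then have "AE x in M. f x * indicator A x - g x * indicator A x = 0"
    using integral_nonneg_eq_0_iff_AE[OF Bochner_Integration.integrable_diff[OF i] nn] by simp
  with AE_space show ?thesis by eventually_elim (auto simp: A_def indicator_def split: if_splits)
qed

lemma integrable_fatou:
  fixes f :: "nat \<Rightarrow> 'a \<Rightarrow> real"
  assumes f: "\<And>n. integrable M (f n)" "\<And>n x. x \<in> space M \<Longrightarrow> 0 \<le> f n x" "\<And>n. (LINT x|M. f n x) \<le> C"
    and lim: "\<And>x. x \<in> space M \<Longrightarrow> (\<lambda>n. f n x) \<longlonglongrightarrow> g x"
  shows "integrable M g"
proof (rule integrableI_nonneg)
  have [measurable]: "f n \<in> borel_measurable M" for n using f by auto
  show "g \<in> borel_measurable M" by (rule borel_measurable_LIMSEQ_real[OF lim]) auto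
  show "AE x in M. 0 \<le> g x"
    by (intro AE_I2 LIMSEQ_le_const[OF lim]) (use f(2) in auto)
  have "(\<integral>\<^sup>+x. ennreal (g x) \<partial>M) = (\<integral>\<^sup>+x. liminf (\<lambda>n. ennreal (f n x)) \<partial>M)"
    using lim by (intro nn_integral_cong lim_imp_Liminf[symmetric] tendsto_ennrealI) auto
  also have "\<dots> \<le> liminf (\<lambda>n. \<integral>\<^sup>+x. ennreal (f n x) \<partial>M)"
    by (rule nn_integral_liminf) measurable
  also have "\<dots> \<le> liminf (\<lambda>n. ennreal C)"
  proof (intro Liminf_mono always_eventually allI)
    fix n
    have "(\<integral>\<^sup>+x. ennreal (f n x) \<partial>M) = ennreal (LINT x|M. f n x)"
      using f by (intro nn_integral_eq_integral) auto
    then show "(\<integral>\<^sup>+x. ennreal (f n x) \<partial>M) \<le> ennreal C" using f(3) by (simp add: ennreal_leI)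
  qed
  also have "\<dots> < \<infinity>" by (simp add: Liminf_const)
  finally show "(\<integral>\<^sup>+x. ennreal (g x) \<partial>M) < \<infinity>" .
qed

section \<open>Smooth maxima\<close>

text \<open>The log-sum-exp function at inverse temperature \<open>l\<close>; it exceeds the maximum
  by at most \<open>ln (card I) / l\<close>.\<close>

definition softmax :: "real \<Rightarrow> 'i set \<Rightarrow> ('i \<Rightarrow> real) \<Rightarrow> real" where
  "softmax l I x = ln (\<Sum>i\<in>I. exp (l * x i)) / l"

text \<open>The partial derivatives of \<open>softmax\<close>: the Gibbs weights, which form a
  probability vector on \<open>I\<close>.\<close>

definition softmax_weight :: "real \<Rightarrow> 'i set \<Rightarrow> ('i \<Rightarrow> real) \<Rightarrow> 'i \<Rightarrow> real" where
  "softmax_weight l I x i = exp (l * x i) / (\<Sum>j\<in>I. exp (l * x j))"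

text \<open>Combines monotonicity with the fact that a constant added to all coordinates is added to
  the value. These two properties are all that the reflection argument uses of the smooth
  maximum.\<close>

lemma softmax_add_le:
  assumes "finite I" "I \<noteq> {}" "0 < l" and le: "\<And>i. i \<in> I \<Longrightarrow> x i + c \<le> y i"
  shows "softmax l I x + c \<le> softmax l I y"
proof -
  have pos: "0 < (\<Sum>i\<in>I. exp (l * x i))" "0 < (\<Sum>i\<in>I. exp (l * y i))"
    using assms by (auto intro!: sum_pos)
  have "exp (l * c) * (\<Sum>i\<in>I. exp (l * x i)) = (\<Sum>i\<in>I. exp (l * (x i + c)))"
    by (simp add: sum_distrib_left distrib_left exp_add mult.commute)
  also have "\<dots> \<le> (\<Sum>i\<in>I. exp (l * y i))"
    using le \<open>0 < l\<close> by (intro sum_mono) simp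
  finally have "ln (exp (l * c) * (\<Sum>i\<in>I. exp (l * x i))) \<le> ln (\<Sum>i\<in>I. exp (l * y i))"
    using pos by (subst ln_le_cancel_iff) auto
  then have "l * c + ln (\<Sum>i\<in>I. exp (l * x i)) \<le> ln (\<Sum>i\<in>I. exp (l * y i))"
    using pos by (simp add: ln_mult)
  then have "(l * c + ln (\<Sum>i\<in>I. exp (l * x i))) / l \<le> ln (\<Sum>i\<in>I. exp (l * y i)) / l"
    using \<open>0 < l\<close> by (intro divide_right_mono) auto
  then show ?thesis using \<open>0 < l\<close> by (simp add: softmax_def add_divide_distrib)
qed

lemma softmax_ge:
  assumes "finite I" "i \<in> I" "0 < l"
  shows "x i \<le> softmax l I x"
proof -
  have "exp (l * x i) \<le> (\<Sum>i\<in>I. exp (l * x i))"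
    using assms by (intro member_le_sum) auto
  moreover have "0 < (\<Sum>i\<in>I. exp (l * x i))"
    using assms by (auto intro!: sum_pos)
  ultimately have "l * x i \<le> ln (\<Sum>i\<in>I. exp (l * x i))"
    by (simp add: ln_ge_iff)
  then show ?thesis using \<open>0 < l\<close> by (simp add: softmax_def field_simps)
qed

lemma softmax_le:
  assumes "finite I" "I \<noteq> {}" "0 < l" and le: "\<And>i. i \<in> I \<Longrightarrow> x i \<le> m"
  shows "softmax l I x \<le> m + ln (real (card I)) / l"
proof -
  have pos: "0 < (\<Sum>i\<in>I. exp (l * x i))" and card: "0 < card I"
    using assms by (auto intro!: sum_pos simp: card_gt_0_iff)
  have "(\<Sum>i\<in>I. exp (l * x i)) \<le> (\<Sum>i\<in>I. exp (l * m))"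
    using le \<open>0 < l\<close> by (intro sum_mono) simp
  then have "ln (\<Sum>i\<in>I. exp (l * x i)) \<le> ln (real (card I) * exp (l * m))"
    using pos card by (subst ln_le_cancel_iff) auto
  then have "ln (\<Sum>i\<in>I. exp (l * x i)) \<le> ln (real (card I)) + l * m"
    using card by (simp add: ln_mult)
  then show ?thesis using \<open>0 < l\<close> by (simp add: softmax_def field_simps)
qed

lemma abs_softmax_le:
  assumes "finite I" "I \<noteq> {}" "0 < l"
  shows "\<bar>softmax l I x\<bar> \<le> (\<Sum>i\<in>I. \<bar>x i\<bar>) + ln (real (card I)) / l"
proof -
  obtain i where i: "i \<in> I" using assms by auto
  have le: "\<bar>x i\<bar> \<le> (\<Sum>i\<in>I. \<bar>x i\<bar>)" if "i \<in> I" for i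
    using that assms by (intro member_le_sum) auto
  have "0 \<le> ln (real (card I)) / l"
    using assms by (auto intro!: divide_nonneg_pos ln_ge_zero simp: Suc_le_eq card_gt_0_iff)
  moreover have "softmax l I x \<le> (\<Sum>i\<in>I. \<bar>x i\<bar>) + ln (real (card I)) / l"
    using le by (intro softmax_le assms) force
  moreover have "x i \<le> softmax l I x" by (rule softmax_ge) (use assms i in auto)
  ultimately show ?thesis using le[OF i] by linarith
qed

lemma softmax_cong: "(\<And>i. i \<in> I \<Longrightarrow> x i = y i) \<Longrightarrow> softmax l I x = softmax l I y"
  unfolding softmax_def by (metis (no_types, lifting) sum.cong)

lemma softmax_weight_nonneg: "0 \<le> softmax_weight l I x i"
  unfolding softmax_weight_def by (intro divide_nonneg_nonneg sum_nonneg) auto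

lemma sum_softmax_weight:
  assumes "finite I" "I \<noteq> {}"
  shows "(\<Sum>i\<in>I. softmax_weight l I x i) = 1"
proof -
  have "0 < (\<Sum>i\<in>I. exp (l * x i))" using assms by (auto intro!: sum_pos)
  then show ?thesis by (simp add: softmax_weight_def sum_divide_distrib[symmetric])
qed

lemma softmax_weight_le_1:
  assumes "finite I" "i \<in> I"
  shows "softmax_weight l I x i \<le> 1"
proof -
  have "softmax_weight l I x i \<le> (\<Sum>j\<in>I. softmax_weight l I x j)"
    using assms by (intro member_le_sum) (auto simp: softmax_weight_nonneg)
  also have "\<dots> = 1" using assms by (intro sum_softmax_weight) auto
  finally show ?thesis .
qed

lemma softmax_has_derivative:
  assumes "finite I" "I \<noteq> {}" "0 < l"
    and x: "\<And>i. i \<in> I \<Longrightarrow> ((\<lambda>s. x s i) has_real_derivative x' i) (at s)"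
  shows "((\<lambda>s. softmax l I (x s)) has_real_derivative (\<Sum>i\<in>I. softmax_weight l I (x s) i * x' i)) (at s)"
proof -
  have pos: "0 < (\<Sum>i\<in>I. exp (l * x s i))" using assms by (auto intro!: sum_pos)
  have "((\<lambda>s. ln (\<Sum>i\<in>I. exp (l * x s i)) / l) has_real_derivative
      (\<Sum>i\<in>I. exp (l * x s i) * (l * x' i)) / (\<Sum>i\<in>I. exp (l * x s i)) / l) (at s)"
    using pos \<open>0 < l\<close> by (auto intro!: derivative_eq_intros x simp: mult_ac)
  also have "(\<Sum>i\<in>I. exp (l * x s i) * (l * x' i)) / (\<Sum>i\<in>I. exp (l * x s i)) / l
      = (\<Sum>i\<in>I. softmax_weight l I (x s) i * x' i)"
    unfolding sum_divide_distrib using \<open>0 < l\<close>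
    by (intro sum.cong refl) (simp add: softmax_weight_def)
  finally show ?thesis unfolding softmax_def .
qed

lemma measurable_softmax[measurable (raw)]:
  assumes "\<And>i. i \<in> I \<Longrightarrow> (\<lambda>w. x w i) \<in> borel_measurable M"
  shows "(\<lambda>w. softmax l I (x w)) \<in> borel_measurable M"
  unfolding softmax_def using assms by measurable

lemma measurable_softmax_weight[measurable (raw)]:
  assumes "\<And>i. i \<in> I \<Longrightarrow> (\<lambda>w. x w i) \<in> borel_measurable M" "i \<in> I"
  shows "(\<lambda>w. softmax_weight l I (x w) i) \<in> borel_measurable M"
  unfolding softmax_weight_def using assms by measurable

text \<open>For \<open>r \<ge> 0\<close> every coordinate grows by an amount between
  \<open>\<alpha> * r\<close> and \<open>\<beta> * r\<close>, hence so does the softmax. For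
  negative \<open>r\<close> the order is reversed, and multiplying by \<open>r\<close> reverses it
  again; the factor \<open>r\<close> therefore gives both signs the same form.\<close>

lemma softmax_shift_bounds:
  assumes "finite I" "I \<noteq> {}" "0 < l"
    and k: "\<And>j. j \<in> I \<Longrightarrow> \<alpha> \<le> k j \<and> k j \<le> \<beta>" and v: "\<And>j. j \<in> I \<Longrightarrow> v j = u j + k j * r"
  shows "\<alpha> * r\<^sup>2 \<le> (softmax l I v - softmax l I u) * r"
    and "(softmax l I v - softmax l I u) * r \<le> \<beta> * r\<^sup>2"
proof -
  have "\<alpha> * r\<^sup>2 \<le> (softmax l I v - softmax l I u) * r \<and> (softmax l I v - softmax l I u) * r \<le> \<beta> * r\<^sup>2"
  proof (cases "0 \<le> r")
    case True
    have "softmax l I u + \<alpha> * r \<le> softmax l I v"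
      using k[THEN conjunct1, THEN mult_right_mono, OF _ True] k[THEN conjunct2, THEN mult_right_mono, OF _ True] v
      by (intro softmax_add_le[OF assms(1-3)]) simp
    moreover have "softmax l I v + - (\<beta> * r) \<le> softmax l I u"
      using k[THEN conjunct1, THEN mult_right_mono, OF _ True] k[THEN conjunct2, THEN mult_right_mono, OF _ True] v
      by (intro softmax_add_le[OF assms(1-3)]) simp
    ultimately have "\<alpha> * r \<le> softmax l I v - softmax l I u" "softmax l I v - softmax l I u \<le> \<beta> * r" by linarith+
    then show ?thesis using True unfolding power2_eq_square mult.assoc[symmetric] by (intro conjI mult_right_mono)
  next
    case False
    then have r: "r \<le> 0" by simp
    have "softmax l I u + \<beta> * r \<le> softmax l I v"
      using k[THEN conjunct1, THEN mult_right_mono_neg, OF _ r] k[THEN conjunct2, THEN mult_right_mono_neg, OF _ r] v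
      by (intro softmax_add_le[OF assms(1-3)]) simp
    moreover have "softmax l I v + - (\<alpha> * r) \<le> softmax l I u"
      using k[THEN conjunct1, THEN mult_right_mono_neg, OF _ r] k[THEN conjunct2, THEN mult_right_mono_neg, OF _ r] v
      by (intro softmax_add_le[OF assms(1-3)]) simp
    ultimately have "\<beta> * r \<le> softmax l I v - softmax l I u" "softmax l I v - softmax l I u \<le> \<alpha> * r" by linarith+
    then show ?thesis using r unfolding power2_eq_square mult.assoc[symmetric] by (intro conjI mult_right_mono_neg)
  qed
  then show "\<alpha> * r\<^sup>2 \<le> (softmax l I v - softmax l I u) * r"
    "(softmax l I v - softmax l I u) * r \<le> \<beta> * r\<^sup>2" by auto
qed

section \<open>A covariance inequality for Gaussian vectors\<close>

text \<open>
  The characteristic function encodes a centered Gaussian vector without requiring its covariance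
  matrix to be invertible.
\<close>

locale gaussian_vector = prob_space M for M :: "'a measure" +
  fixes I :: "'i set" and X :: "'i \<Rightarrow> 'a \<Rightarrow> real"
  assumes fin: "finite I" and ne: "I \<noteq> {}"
    and X_meas[measurable]: "\<And>i. X i \<in> borel_measurable M"
    and X_sq: "\<And>i. integrable M (\<lambda>\<omega>. (X i \<omega>)\<^sup>2)"
    and X_char: "\<And>c. (CLINT \<omega>|M. iexp (\<Sum>i\<in>I. c i * X i \<omega>)) =
       exp (- ((LINT \<omega>|M. (\<Sum>i\<in>I. c i * X i \<omega>)\<^sup>2) / 2))"
begin

definition K where "K i j = (LINT \<omega>|M. X i \<omega> * X j \<omega>)"

abbreviation P where "P \<equiv> M \<Otimes>\<^sub>M M"

text \<open>
  \<open>XL\<close> and \<open>XR\<close> are independent copies of the vector; \<open>(U s, V s)\<close> below is their rotation by the angle \<open>s\<close>.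
\<close>

abbreviation XL where "XL \<omega> i \<equiv> X i (fst \<omega>)"
abbreviation XR where "XR \<omega> i \<equiv> X i (snd \<omega>)"

sublocale P: pair_prob_space M M ..

lemma integrable_XX: "integrable M (\<lambda>\<omega>. X i \<omega> * X j \<omega>)"
  by (intro integrable_mult_of_squares X_meas X_sq)

lemma lin_sq: "integrable M (\<lambda>\<omega>. (\<Sum>i\<in>J. c i * X i \<omega>)\<^sup>2)"
proof (induction J rule: infinite_finite_induct)
  case (insert j J)
  have "integrable M (\<lambda>\<omega>. (c j * X j \<omega> + (\<Sum>i\<in>J. c i * X i \<omega>))\<^sup>2)"
    using insert by (intro integrable_add_square) (auto simp: power_mult_distrib X_sq)
  then show ?case using insert by simp
qed auto

section \<open>Transformations of two independent copies that preserve their joint law\<close>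

lemma char_pair:
  "(CLINT \<omega>|P. iexp ((\<Sum>i\<in>I. a i * XL \<omega> i) + (\<Sum>i\<in>I. b i * XR \<omega> i))) =
     exp (- (((LINT \<omega>|M. (\<Sum>i\<in>I. a i * X i \<omega>)\<^sup>2) + (LINT \<omega>|M. (\<Sum>i\<in>I. b i * X i \<omega>)\<^sup>2)) / 2))"
proof -
  have "integrable P (\<lambda>\<omega>. iexp ((\<Sum>i\<in>I. a i * XL \<omega> i) + (\<Sum>i\<in>I. b i * XR \<omega> i)))"
    by (intro P.integrable_const_bound[where B=1]) auto
  from P.integral_fst'[OF this]
  have "(CLINT \<omega>|P. iexp ((\<Sum>i\<in>I. a i * XL \<omega> i) + (\<Sum>i\<in>I. b i * XR \<omega> i))) =
    (CLINT \<omega>|M. CLINT \<omega>'|M. iexp (\<Sum>i\<in>I. a i * X i \<omega>) * iexp (\<Sum>i\<in>I. b i * X i \<omega>'))"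
    by (simp only: fst_conv snd_conv of_real_add distrib_left exp_add)
  also have "\<dots> = (CLINT \<omega>|M. iexp (\<Sum>i\<in>I. a i * X i \<omega>)) * (CLINT \<omega>|M. iexp (\<Sum>i\<in>I. b i * X i \<omega>))"
    by (simp only: integral_mult_left_zero integral_mult_right_zero)
  finally show ?thesis
    by (simp only: X_char) (simp add: exp_add[symmetric] exp_of_real[symmetric] add_divide_distrib)
qed

text \<open>The sum type \<open>I <+> I\<close> joins the two vectors into one family, to which
  \<open>char_family_unique\<close> applies. That theorem only sees families restricted to the index
  set, which is why \<open>f\<close> has to ignore values outside \<open>I\<close>.\<close>

lemma invariance:
  fixes f :: "('i \<Rightarrow> real) \<Rightarrow> ('i \<Rightarrow> real) \<Rightarrow> real"
  assumes [measurable]: "\<And>i. (\<lambda>\<omega>. Y \<omega> i) \<in> borel_measurable P" "\<And>i. (\<lambda>\<omega>. Y' \<omega> i) \<in> borel_measurable P"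
    and char: "\<And>a b. (CLINT \<omega>|P. iexp ((\<Sum>i\<in>I. a i * Y \<omega> i) + (\<Sum>i\<in>I. b i * Y' \<omega> i))) =
      exp (- (((LINT \<omega>|M. (\<Sum>i\<in>I. a i * X i \<omega>)\<^sup>2) + (LINT \<omega>|M. (\<Sum>i\<in>I. b i * X i \<omega>)\<^sup>2)) / 2))"
    and f[measurable]: "(\<lambda>z. f (\<lambda>i. z (Inl i)) (\<lambda>i. z (Inr i))) \<in> borel_measurable (\<Pi>\<^sub>M k\<in>I <+> I. borel)"
    and f_cong: "\<And>x x' y y'. (\<And>i. i \<in> I \<Longrightarrow> x i = x' i) \<Longrightarrow> (\<And>i. i \<in> I \<Longrightarrow> y i = y' i) \<Longrightarrow> f x y = f x' y'"
  shows "(LINT \<omega>|P. f (Y \<omega>) (Y' \<omega>)) = (LINT \<omega>|P. f (XL \<omega>) (XR \<omega>))"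
proof -
  let ?J = "I <+> I"
  let ?V = "\<lambda>k \<omega>. case k of Inl i \<Rightarrow> Y \<omega> i | Inr i \<Rightarrow> Y' \<omega> i"
  let ?W = "\<lambda>k \<omega>. case k of Inl i \<Rightarrow> XL \<omega> i | Inr i \<Rightarrow> XR \<omega> i"
  have J: "finite ?J" using fin by simp
  have V: "?V k \<in> borel_measurable P" "?W k \<in> borel_measurable P" for k
    by (cases k; simp)+
  have "distr P (\<Pi>\<^sub>M k\<in>?J. borel) (\<lambda>\<omega>. \<lambda>k\<in>?J. ?V k \<omega>) = distr P (\<Pi>\<^sub>M k\<in>?J. borel) (\<lambda>\<omega>. \<lambda>k\<in>?J. ?W k \<omega>)"
  proof (rule char_family_unique[OF P.prob_space_axioms P.prob_space_axioms J V])
    fix c :: "'i + 'i \<Rightarrow> real"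
    show "(CLINT \<omega>|P. iexp (\<Sum>j\<in>?J. c j * ?V j \<omega>)) = (CLINT \<omega>|P. iexp (\<Sum>j\<in>?J. c j * ?W j \<omega>))"
      using char[of "c \<circ> Inl" "c \<circ> Inr"] char_pair[of "c \<circ> Inl" "c \<circ> Inr"]
      by (simp add: sum.Plus[OF fin fin] del: of_real_add of_real_sum)
  qed
  then have "(LINT z|distr P (\<Pi>\<^sub>M k\<in>?J. borel) (\<lambda>\<omega>. \<lambda>k\<in>?J. ?V k \<omega>). f (\<lambda>i. z (Inl i)) (\<lambda>i. z (Inr i))) =
     (LINT z|distr P (\<Pi>\<^sub>M k\<in>?J. borel) (\<lambda>\<omega>. \<lambda>k\<in>?J. ?W k \<omega>). f (\<lambda>i. z (Inl i)) (\<lambda>i. z (Inr i)))"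
    by simp
  moreover have "(LINT z|distr P (\<Pi>\<^sub>M k\<in>?J. borel) (\<lambda>\<omega>. \<lambda>k\<in>?J. ?V k \<omega>). f (\<lambda>i. z (Inl i)) (\<lambda>i. z (Inr i))) =
     (LINT \<omega>|P. f (Y \<omega>) (Y' \<omega>))"
  proof (subst integral_distr[OF measurable_restrict f])
    show "?V k \<in> borel_measurable P" for k by (rule V)
    show "(LINT \<omega>|P. f (\<lambda>i. (\<lambda>k\<in>?J. ?V k \<omega>) (Inl i)) (\<lambda>i. (\<lambda>k\<in>?J. ?V k \<omega>) (Inr i))) = (LINT \<omega>|P. f (Y \<omega>) (Y' \<omega>))"
      by (intro Bochner_Integration.integral_cong refl f_cong) auto
  qed
  moreover have "(LINT z|distr P (\<Pi>\<^sub>M k\<in>?J. borel) (\<lambda>\<omega>. \<lambda>k\<in>?J. ?W k \<omega>). f (\<lambda>i. z (Inl i)) (\<lambda>i. z (Inr i))) =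
     (LINT \<omega>|P. f (XL \<omega>) (XR \<omega>))"
  proof (subst integral_distr[OF measurable_restrict f])
    show "?W k \<in> borel_measurable P" for k by (rule V)
    show "(LINT \<omega>|P. f (\<lambda>i. (\<lambda>k\<in>?J. ?W k \<omega>) (Inl i)) (\<lambda>i. (\<lambda>k\<in>?J. ?W k \<omega>) (Inr i))) = (LINT \<omega>|P. f (XL \<omega>) (XR \<omega>))"
      by (intro Bochner_Integration.integral_cong refl f_cong) auto
  qed
  ultimately show ?thesis by simp
qed

definition U where "U s \<omega> i = cos s * XL \<omega> i + sin s * XR \<omega> i"
definition V where "V s \<omega> i = - sin s * XL \<omega> i + cos s * XR \<omega> i"

lemma UV_cancel: "cos s * U s \<omega> i - sin s * V s \<omega> i = XL \<omega> i"
proof -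
  have "c * (c * p + d * q) - d * (- d * p + c * q) = (c\<^sup>2 + d\<^sup>2) * p" for c d p q :: real
    by (simp add: power2_eq_square algebra_simps)
  then show ?thesis unfolding U_def V_def by (metis sin_cos_squared_add2 mult_1_left)
qed

lemma measurable_UV[measurable]:
  "(\<lambda>\<omega>. U s \<omega> i) \<in> borel_measurable P" "(\<lambda>\<omega>. V s \<omega> i) \<in> borel_measurable P"
  unfolding U_def V_def by measurable

lemma integrable_XLR: "integrable P (\<lambda>\<omega>. (XL \<omega> i)\<^sup>2)" "integrable P (\<lambda>\<omega>. (XR \<omega> i)\<^sup>2)"
  using P.integrable_mult_pair[OF X_sq[of i], of "\<lambda>_. 1"] P.integrable_mult_pair[OF _ X_sq[of i], of "\<lambda>_. 1"]
  by simp_all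

lemma integrable_UV: "integrable P (\<lambda>\<omega>. (U s \<omega> i)\<^sup>2)" "integrable P (\<lambda>\<omega>. (V s \<omega> i)\<^sup>2)"
  unfolding U_def V_def
  by (intro integrable_add_square; simp add: power_mult_distrib integrable_XLR)+

text \<open>
  Since \<open>XL = cos s U - sin s V\<close>, the sum over \<open>i\<close> of \<open>G l \<psi> s i (U s) (V s)\<close> is the \<open>s\<close>-derivative of
  \<open>F(XL) \<phi>(F(U s))\<close>, where \<open>F = softmax l I\<close> and \<open>\<phi>' = \<psi>\<close>.
\<close>

definition G :: "real \<Rightarrow> (real \<Rightarrow> real) \<Rightarrow> real \<Rightarrow> 'i \<Rightarrow> ('i \<Rightarrow> real) \<Rightarrow> ('i \<Rightarrow> real) \<Rightarrow> real" where
  "G l \<psi> s i x y = softmax l I (\<lambda>j. cos s * x j - sin s * y j) *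
     (\<psi> (softmax l I x) * softmax_weight l I x i) * y i"

lemma G_cong:
  assumes "i \<in> I" "\<And>i. i \<in> I \<Longrightarrow> x i = x' i" "\<And>i. i \<in> I \<Longrightarrow> y i = y' i"
  shows "G l \<psi> s i x y = G l \<psi> s i x' y'"
proof -
  have "softmax l I (\<lambda>j. cos s * x j - sin s * y j) = softmax l I (\<lambda>j. cos s * x' j - sin s * y' j)"
    "softmax l I x = softmax l I x'"
    using assms by (auto intro!: softmax_cong)
  moreover have "softmax_weight l I x i = softmax_weight l I x' i"
    unfolding softmax_weight_def using assms by (simp cong: sum.cong)
  ultimately show ?thesis using assms unfolding G_def by simp
qed

lemma measurable_G:
  assumes "i \<in> I" and [measurable]: "\<psi> \<in> borel_measurable borel"
    "\<And>i. i \<in> I \<Longrightarrow> (\<lambda>w. x w i) \<in> borel_measurable N" "\<And>i. i \<in> I \<Longrightarrow> (\<lambda>w. y w i) \<in> borel_measurable N"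
  shows "(\<lambda>w. G l \<psi> s i (x w) (y w)) \<in> borel_measurable N"
  unfolding G_def using \<open>i \<in> I\<close> by measurable

text \<open>The softmax grows at most linearly and the middle factor is bounded, so \<open>G\<close>
  is dominated by a product of two square integrable functions. General \<open>x\<close> and
  \<open>y\<close> allow for the original, the rotated and the reflected pair.\<close>

lemma integrable_G:
  assumes i: "i \<in> I" and [measurable]: "\<psi> \<in> borel_measurable borel"
    and \<psi>: "\<And>x. 0 \<le> \<psi> x" "\<And>x. \<psi> x \<le> C" and "0 < l"
    and [measurable]: "\<And>i. (\<lambda>w. x w i) \<in> borel_measurable P" "\<And>i. (\<lambda>w. y w i) \<in> borel_measurable P"
    and x: "\<And>i. integrable P (\<lambda>w. (x w i)\<^sup>2)" and y: "\<And>i. integrable P (\<lambda>w. (y w i)\<^sup>2)"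
  shows "integrable P (\<lambda>w. G l \<psi> s i (x w) (y w))"
proof -
  define k where "k = ln (real (card I)) / l"
  have C: "0 \<le> C" using \<psi>[of 0] by linarith
  define B where "B w = (\<Sum>j\<in>I. \<bar>cos s * x w j - sin s * y w j\<bar>) + k" for w
  have [measurable]: "B \<in> borel_measurable P" unfolding B_def by measurable
  have "integrable P (\<lambda>w. (cos s * x w j + - sin s * y w j)\<^sup>2)" for j
    using x y by (intro integrable_add_square) (auto simp: power_mult_distrib)
  then have "integrable P (\<lambda>w. (B w)\<^sup>2)"
    unfolding B_def by (intro integrable_add_square integrable_sum_square) auto
  then have "integrable P (\<lambda>w. C * (B w * y w i))"
    by (intro integrable_mult_right integrable_mult_of_squares y) measurable
  then show ?thesis
  proof (rule Bochner_Integration.integrable_bound)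
    show "(\<lambda>w. G l \<psi> s i (x w) (y w)) \<in> borel_measurable P"
      by (rule measurable_G[OF i]) measurable
    have "\<bar>G l \<psi> s i (x w) (y w)\<bar> \<le> \<bar>C * (B w * y w i)\<bar>" for w
    proof -
      have "\<bar>softmax l I (\<lambda>j. cos s * x w j - sin s * y w j)\<bar> \<le> \<bar>B w\<bar>"
        unfolding B_def k_def using abs_softmax_le[OF fin ne \<open>0 < l\<close>] by (rule order_trans) simp
      moreover have "\<bar>\<psi> (softmax l I (x w)) * softmax_weight l I (x w) i\<bar> \<le> C * 1"
        unfolding abs_mult using \<psi> C softmax_weight_le_1[OF fin i, of l "x w"] softmax_weight_nonneg[of l I "x w" i]
        by (intro mult_mono) auto
      ultimately have "\<bar>softmax l I (\<lambda>j. cos s * x w j - sin s * y w j)\<bar> *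
         \<bar>\<psi> (softmax l I (x w)) * softmax_weight l I (x w) i\<bar> * \<bar>y w i\<bar> \<le> \<bar>B w\<bar> * (C * 1) * \<bar>y w i\<bar>"
        by (intro mult_mono) auto
      then show ?thesis using C unfolding G_def by (simp only: abs_mult) (simp add: mult_ac)
    qed
    then show "AE w in P. norm (G l \<psi> s i (x w) (y w)) \<le> norm (C * (B w * y w i))" by simp
  qed
qed

lemma measurable_G_PiM:
  assumes "i \<in> I" "\<psi> \<in> borel_measurable borel"
  shows "(\<lambda>z. G l \<psi> s i (\<lambda>i. z (Inl i)) (\<lambda>i. z (Inr i))) \<in> borel_measurable (\<Pi>\<^sub>M k\<in>I <+> I. borel)"
  by (rule measurable_G[OF assms]) (auto intro!: measurable_component_singleton)

text \<open>Moved onto the coefficients \<open>a\<close> and \<open>b\<close>, the rotation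
  preserves the sum of the two variances, since the mixed terms cancel. Afterwards the angle
  survives only inside the first softmax of \<open>G\<close>.\<close>

lemma rotation:
  assumes "i \<in> I" "\<psi> \<in> borel_measurable borel"
  shows "(LINT \<omega>|P. G l \<psi> s i (U s \<omega>) (V s \<omega>)) = (LINT \<omega>|P. G l \<psi> s i (XL \<omega>) (XR \<omega>))"
proof (rule invariance[OF measurable_UV _ measurable_G_PiM[OF assms] G_cong[OF assms(1)]])
  fix a b :: "'i \<Rightarrow> real"
  let ?A = "\<lambda>\<omega>. \<Sum>i\<in>I. a i * X i \<omega>" and ?B = "\<lambda>\<omega>. \<Sum>i\<in>I. b i * X i \<omega>"
  have e: "(\<Sum>i\<in>I. a i * U s \<omega> i) + (\<Sum>i\<in>I. b i * V s \<omega> i) =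
    (\<Sum>i\<in>I. (cos s * a i - sin s * b i) * XL \<omega> i) + (\<Sum>i\<in>I. (sin s * a i + cos s * b i) * XR \<omega> i)" for \<omega>
    unfolding sum.distrib[symmetric] by (intro sum.cong refl) (simp add: U_def V_def algebra_simps)
  have [simp]: "integrable M (\<lambda>\<omega>. ?A \<omega> * ?B \<omega>)"
    by (intro integrable_mult_of_squares lin_sq) measurable
  have "(\<Sum>i\<in>I. (cos s * a i - sin s * b i) * X i \<omega>)\<^sup>2 + (\<Sum>i\<in>I. (sin s * a i + cos s * b i) * X i \<omega>)\<^sup>2
     = (?A \<omega>)\<^sup>2 + (?B \<omega>)\<^sup>2" for \<omega>
  proof -
    have "(\<Sum>i\<in>I. (cos s * a i - sin s * b i) * X i \<omega>) = cos s * ?A \<omega> - sin s * ?B \<omega>"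
      "(\<Sum>i\<in>I. (sin s * a i + cos s * b i) * X i \<omega>) = sin s * ?A \<omega> + cos s * ?B \<omega>"
      by (simp_all add: sum_distrib_left sum_subtractf sum.distrib left_diff_distrib distrib_right mult.assoc)
    moreover have "(c * p - d * q)\<^sup>2 + (d * p + c * q)\<^sup>2 = (c\<^sup>2 + d\<^sup>2) * (p\<^sup>2 + q\<^sup>2)" for c d p q :: real
      by (simp add: power2_eq_square algebra_simps)
    ultimately show ?thesis by (simp only: sin_cos_squared_add2 mult_1_left)
  qed
  then have "(LINT \<omega>|M. (\<Sum>i\<in>I. (cos s * a i - sin s * b i) * X i \<omega>)\<^sup>2) + (LINT \<omega>|M. (\<Sum>i\<in>I. (sin s * a i + cos s * b i) * X i \<omega>)\<^sup>2)
    = (LINT \<omega>|M. (?A \<omega>)\<^sup>2) + (LINT \<omega>|M. (?B \<omega>)\<^sup>2)"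
    by (simp only: Bochner_Integration.integral_add[OF lin_sq lin_sq, symmetric])
  then show "(CLINT \<omega>|P. iexp ((\<Sum>i\<in>I. a i * U s \<omega> i) + (\<Sum>i\<in>I. b i * V s \<omega> i))) =
      exp (- (((LINT \<omega>|M. (?A \<omega>)\<^sup>2) + (LINT \<omega>|M. (?B \<omega>)\<^sup>2)) / 2))"
    by (simp only: e char_pair)
qed

text \<open>\<open>K i j / K i i * XR \<omega> i\<close> is the projection of
  \<open>XR \<omega> j\<close> onto \<open>XR \<omega> i\<close>. The reflection flips this
  projection and keeps the uncorrelated remainder; in particular it negates coordinate
  \<open>i\<close>.\<close>

definition refl_at where "refl_at i \<omega> j = XR \<omega> j - 2 * K i j / K i i * XR \<omega> i"

lemma reflection:
  assumes i: "i \<in> I" and \<psi>: "\<psi> \<in> borel_measurable borel" and Kii: "0 < K i i"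
  shows "(LINT \<omega>|P. G l \<psi> s i (XL \<omega>) (refl_at i \<omega>)) = (LINT \<omega>|P. G l \<psi> s i (XL \<omega>) (XR \<omega>))"
proof (rule invariance[OF _ _ _ measurable_G_PiM[OF i \<psi>] G_cong[OF i]])
  fix a b :: "'i \<Rightarrow> real"
  let ?A = "\<lambda>\<omega>. \<Sum>i\<in>I. a i * X i \<omega>" and ?B = "\<lambda>\<omega>. \<Sum>i\<in>I. b i * X i \<omega>"
  \<comment> \<open>\<open>t\<close> is the covariance of \<open>?B\<close> with \<open>X i\<close>,
    and \<open>b'\<close> is \<open>b\<close> under the transposed reflection, which alters only
    coefficient \<open>i\<close>. In the new variance the terms \<open>- 4 t^2 / K i i\<close> and
    \<open>4 t^2 / K i i\<close> cancel.\<close>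
  define t where "t = (\<Sum>j\<in>I. b j * K i j)"
  define b' where "b' j = (if j = i then b i - 2 * t / K i i else b j)" for j
  have B': "(\<Sum>j\<in>I. b' j * z j) = (\<Sum>j\<in>I. b j * z j) - 2 * t / K i i * z i" for z :: "'i \<Rightarrow> real"
    using i fin unfolding b'_def
    by (simp add: sum.remove[OF fin i] left_diff_distrib)
  have e: "(\<Sum>j\<in>I. b j * refl_at i \<omega> j) = (\<Sum>j\<in>I. b' j * XR \<omega> j)" for \<omega>
    by (simp add: B' refl_at_def right_diff_distrib sum_subtractf t_def sum_divide_distrib sum_distrib_left sum_distrib_right mult_ac)
  have iBX: "integrable M (\<lambda>\<omega>. ?B \<omega> * X i \<omega>)"
    by (intro integrable_mult_of_squares lin_sq X_sq) measurable
  have "(LINT \<omega>|M. ?B \<omega> * X i \<omega>) = (LINT \<omega>|M. (\<Sum>j\<in>I. b j * (X i \<omega> * X j \<omega>)))"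
    unfolding sum_distrib_right by (simp only: mult_ac)
  also have "\<dots> = t"
    unfolding t_def K_def by (subst Bochner_Integration.integral_sum) (simp_all add: integrable_XX)
  finally have t: "t = (LINT \<omega>|M. ?B \<omega> * X i \<omega>)" ..
  have "(LINT \<omega>|M. (\<Sum>j\<in>I. b' j * X j \<omega>)\<^sup>2) =
    (LINT \<omega>|M. (?B \<omega>)\<^sup>2 - 4 * t / K i i * (?B \<omega> * X i \<omega>) + (2 * t / K i i)\<^sup>2 * (X i \<omega> * X i \<omega>))"
    unfolding B' by (intro Bochner_Integration.integral_cong refl) (simp add: power2_eq_square algebra_simps)
  also have "\<dots> = (LINT \<omega>|M. (?B \<omega>)\<^sup>2) - 4 * t / K i i * t + (2 * t / K i i)\<^sup>2 * K i i"
    using lin_sq[of b I] iBX integrable_XX[of i i] by (simp add: t K_def)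
  also have "\<dots> = (LINT \<omega>|M. (?B \<omega>)\<^sup>2)"
    using Kii by (simp add: power2_eq_square field_simps)
  finally show "(CLINT \<omega>|P. iexp ((\<Sum>i\<in>I. a i * XL \<omega> i) + (\<Sum>j\<in>I. b j * refl_at i \<omega> j))) =
      exp (- (((LINT \<omega>|M. (?A \<omega>)\<^sup>2) + (LINT \<omega>|M. (?B \<omega>)\<^sup>2)) / 2))"
    by (simp only: e char_pair)
qed (auto simp: refl_at_def)

text \<open>
  Averaging over the reflection turns the factor \<open>XR i\<close> into an increment of the softmax between two
  points that differ by \<open>2 sin s K i j / K i i XR i\<close> in coordinate \<open>j\<close>; by monotonicity this increment is
  controlled by the bounds on \<open>K\<close>.
\<close>

lemma G_bounds:
  assumes i: "i \<in> I" and [measurable]: "\<psi> \<in> borel_measurable borel"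
    and \<psi>: "\<And>x. 0 \<le> \<psi> x" "\<And>x. \<psi> x \<le> C" and l: "0 < l" and s: "0 \<le> sin s"
    and \<alpha>: "0 < \<alpha>" and Kb: "\<And>i j. i \<in> I \<Longrightarrow> j \<in> I \<Longrightarrow> \<alpha> \<le> K i j \<and> K i j \<le> \<beta>"
  defines "w \<equiv> LINT \<omega>|M. \<psi> (softmax l I (\<lambda>i. X i \<omega>)) * softmax_weight l I (\<lambda>i. X i \<omega>) i"
  shows "sin s * \<alpha> * w \<le> - (LINT \<omega>|P. G l \<psi> s i (XL \<omega>) (XR \<omega>))"
    and "- (LINT \<omega>|P. G l \<psi> s i (XL \<omega>) (XR \<omega>)) \<le> sin s * \<beta> * w"
proof -
  have Kii: "0 < K i i" using Kb[OF i i] \<alpha> by linarith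
  define W where "W x = \<psi> (softmax l I x) * softmax_weight l I x i" for x
  have W0: "0 \<le> W x" for x unfolding W_def using \<psi> softmax_weight_nonneg by (intro mult_nonneg_nonneg) auto
  have W1: "W x \<le> C" for x
    unfolding W_def using mult_mono[of "\<psi> (softmax l I x)" C "softmax_weight l I x i" 1] \<psi> softmax_weight_nonneg[of l I x i] softmax_weight_le_1[OF fin i, of l x]
    by (smt (verit))
  have [measurable]: "(\<lambda>\<omega>. W (\<lambda>i. X i \<omega>)) \<in> borel_measurable M"
    unfolding W_def using i by measurable
  have iW: "integrable M (\<lambda>\<omega>. W (\<lambda>i. X i \<omega>))"
    using W0 W1 by (intro integrable_const_bound[where B = C]) auto
  have w: "w = (LINT \<omega>|M. W (\<lambda>i. X i \<omega>))" by (simp add: w_def W_def)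
  \<comment> \<open>Independence of the copies makes the expectation factor; the resulting
    \<open>K i i\<close> cancels the denominator of \<open>?k\<close> below, so that only the bounds
    on the covariances remain.\<close>
  have iWX: "integrable P (\<lambda>\<omega>. W (XL \<omega>) * (XR \<omega> i)\<^sup>2)"
    and WX: "(LINT \<omega>|P. W (XL \<omega>) * (XR \<omega> i)\<^sup>2) = w * K i i"
    using P.integrable_mult_pair[OF iW X_sq[of i]] P.integral_mult_pair[OF iW X_sq[of i]]
    by (simp_all add: w K_def power2_eq_square)
  have iG: "integrable P (\<lambda>\<omega>. G l \<psi> s i (XL \<omega>) (XR \<omega>))"
    by (rule integrable_G[OF i _ \<psi> l]) (simp_all add: integrable_XLR)
  have "integrable P (\<lambda>\<omega>. (XR \<omega> j + (- (2 * K i j / K i i)) * XR \<omega> i)\<^sup>2)" for j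
    by (rule integrable_add_square) (simp_all only: power_mult_distrib, simp_all add: integrable_XLR)
  then have iR: "integrable P (\<lambda>\<omega>. (refl_at i \<omega> j)\<^sup>2)" for j
    by (simp add: refl_at_def)
  have [measurable]: "(\<lambda>\<omega>. refl_at i \<omega> j) \<in> borel_measurable P" for j
    unfolding refl_at_def by measurable
  have iGR: "integrable P (\<lambda>\<omega>. G l \<psi> s i (XL \<omega>) (refl_at i \<omega>))"
    by (rule integrable_G[OF i _ \<psi> l]) (simp_all add: integrable_XLR iR)
  have sum: "(LINT \<omega>|P. - G l \<psi> s i (XL \<omega>) (XR \<omega>) - G l \<psi> s i (XL \<omega>) (refl_at i \<omega>)) =
     2 * (- (LINT \<omega>|P. G l \<psi> s i (XL \<omega>) (XR \<omega>)))"
    using iG iGR reflection[OF i _ Kii, of \<psi> l s] by simp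
  let ?k = "2 * sin s / K i i"
  have k: "?k * \<alpha> \<le> ?k * K i j \<and> ?k * K i j \<le> ?k * \<beta>" if "j \<in> I" for j
    using Kb[OF i that] s Kii by (intro conjI mult_left_mono) auto
  have R: "refl_at i \<omega> i = - XR \<omega> i" for \<omega> using Kii by (simp add: refl_at_def)
  have pw: "- G l \<psi> s i (XL \<omega>) (XR \<omega>) - G l \<psi> s i (XL \<omega>) (refl_at i \<omega>) =
     W (XL \<omega>) * ((softmax l I (\<lambda>j. cos s * XL \<omega> j - sin s * refl_at i \<omega> j) - softmax l I (\<lambda>j. cos s * XL \<omega> j - sin s * XR \<omega> j)) * XR \<omega> i)" for \<omega>
    unfolding G_def W_def R by (simp add: algebra_simps)
  have v: "cos s * XL \<omega> j - sin s * refl_at i \<omega> j = (cos s * XL \<omega> j - sin s * XR \<omega> j) + ?k * K i j * XR \<omega> i" for \<omega> j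
    by (simp add: refl_at_def algebra_simps)
  have k2: "?k * c * (w * K i i) = 2 * (sin s * c * w)" for c using Kii by simp
  have int_k: "(LINT \<omega>|P. ?k * c * (W (XL \<omega>) * (XR \<omega> i)\<^sup>2)) = 2 * (sin s * c * w)" for c
    using k2[of c] WX by (simp only: integral_mult_right_zero)
  have iL: "integrable P (\<lambda>\<omega>. c * (W (XL \<omega>) * (XR \<omega> i)\<^sup>2))" for c
    using iWX by (rule integrable_mult_right)
  have iS: "integrable P (\<lambda>\<omega>. - G l \<psi> s i (XL \<omega>) (XR \<omega>) - G l \<psi> s i (XL \<omega>) (refl_at i \<omega>))"
    using iG iGR by simp
  let ?D = "\<lambda>\<omega>. softmax l I (\<lambda>j. cos s * XL \<omega> j - sin s * refl_at i \<omega> j) - softmax l I (\<lambda>j. cos s * XL \<omega> j - sin s * XR \<omega> j)"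
  have D: "?k * \<alpha> * (XR \<omega> i)\<^sup>2 \<le> ?D \<omega> * XR \<omega> i" "?D \<omega> * XR \<omega> i \<le> ?k * \<beta> * (XR \<omega> i)\<^sup>2" for \<omega>
    by (rule softmax_shift_bounds[OF fin ne l, where k = "\<lambda>j. ?k * K i j"], erule k, rule v)+
  have lo: "?k * \<alpha> * (W (XL \<omega>) * (XR \<omega> i)\<^sup>2) \<le> - G l \<psi> s i (XL \<omega>) (XR \<omega>) - G l \<psi> s i (XL \<omega>) (refl_at i \<omega>)" for \<omega>
    using mult_left_mono[OF D(1)[of \<omega>] W0[of "XL \<omega>"]] unfolding pw by (simp only: mult.left_commute mult.assoc)
  have hi: "- G l \<psi> s i (XL \<omega>) (XR \<omega>) - G l \<psi> s i (XL \<omega>) (refl_at i \<omega>) \<le> ?k * \<beta> * (W (XL \<omega>) * (XR \<omega> i)\<^sup>2)" for \<omega>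
    using mult_left_mono[OF D(2)[of \<omega>] W0[of "XL \<omega>"]] unfolding pw by (simp only: mult.left_commute mult.assoc)
  have "(LINT \<omega>|P. ?k * \<alpha> * (W (XL \<omega>) * (XR \<omega> i)\<^sup>2)) \<le> (LINT \<omega>|P. - G l \<psi> s i (XL \<omega>) (XR \<omega>) - G l \<psi> s i (XL \<omega>) (refl_at i \<omega>))"
    by (rule integral_mono[OF iL[of "?k * \<alpha>"] iS lo])
  then show "sin s * \<alpha> * w \<le> - (LINT \<omega>|P. G l \<psi> s i (XL \<omega>) (XR \<omega>))"
    unfolding sum int_k by linarith
  have "(LINT \<omega>|P. - G l \<psi> s i (XL \<omega>) (XR \<omega>) - G l \<psi> s i (XL \<omega>) (refl_at i \<omega>)) \<le> (LINT \<omega>|P. ?k * \<beta> * (W (XL \<omega>) * (XR \<omega> i)\<^sup>2))"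
    by (rule integral_mono[OF iS iL[of "?k * \<beta>"] hi])
  then show "- (LINT \<omega>|P. G l \<psi> s i (XL \<omega>) (XR \<omega>)) \<le> sin s * \<beta> * w"
    unfolding sum int_k by linarith
qed

section \<open>Interpolation between a vector and its independent copy\<close>

abbreviation smax where "smax l \<omega> \<equiv> softmax l I (\<lambda>i. X i \<omega>)"

lemma smax_sq: assumes "0 < l" shows "integrable M (\<lambda>\<omega>. (smax l \<omega>)\<^sup>2)"
proof (rule integrable_square_bound)
  show "integrable M (\<lambda>\<omega>. ((\<Sum>i\<in>I. \<bar>X i \<omega>\<bar>) + ln (real (card I)) / l)\<^sup>2)"
    by (intro integrable_add_square integrable_sum_square) (auto simp: X_sq)
  show "\<bar>smax l \<omega>\<bar> \<le> (\<Sum>i\<in>I. \<bar>X i \<omega>\<bar>) + ln (real (card I)) / l" for \<omega>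
    by (rule abs_softmax_le[OF fin ne assms])
qed measurable

lemma path_derivative:
  assumes "0 < l" and \<phi>: "\<And>x. (\<phi> has_real_derivative \<psi> x) (at x)"
  shows "((\<lambda>s. \<phi> (softmax l I (U s \<omega>))) has_real_derivative
     \<psi> (softmax l I (U s \<omega>)) * (\<Sum>i\<in>I. softmax_weight l I (U s \<omega>) i * V s \<omega> i)) (at s)"
proof -
  have "((\<lambda>s. U s \<omega> i) has_real_derivative V s \<omega> i) (at s)" for i
    unfolding U_def V_def by (auto intro!: derivative_eq_intros)
  then show ?thesis
    by (intro DERIV_chain2[OF \<phi>] softmax_has_derivative fin ne \<open>0 < l\<close>)
qed

lemma isCont_path_derivative:
  assumes "0 < l" and \<psi>: "continuous_on UNIV \<psi>"
  shows "isCont (\<lambda>s. \<psi> (softmax l I (U s \<omega>)) * (\<Sum>i\<in>I. softmax_weight l I (U s \<omega>) i * V s \<omega> i)) s"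
proof -
  have U: "isCont (\<lambda>s. U s \<omega> i) s" and V: "isCont (\<lambda>s. V s \<omega> i) s" for i
    unfolding U_def V_def by (intro continuous_intros)+
  have pos: "(\<Sum>i\<in>I. exp (l * x i)) \<noteq> 0" for x :: "'i \<Rightarrow> real"
    using fin ne by (intro less_imp_neq[THEN not_sym] sum_pos) auto
  have "isCont \<psi> x" for x using \<psi> by (simp add: continuous_on_eq_continuous_at)
  moreover have "isCont (\<lambda>s. softmax l I (U s \<omega>)) s"
    using path_derivative[OF \<open>0 < l\<close>, of "\<lambda>x. x" "\<lambda>_. 1" \<omega> s] by (intro DERIV_isCont) auto
  ultimately have "isCont (\<lambda>s. \<psi> (softmax l I (U s \<omega>))) s"
    using isCont_o2 by blast
  moreover have "isCont (\<lambda>s. softmax_weight l I (U s \<omega>) i) s" for i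
    unfolding softmax_weight_def by (intro continuous_intros U pos)
  ultimately show ?thesis by (intro continuous_intros V)
qed

text \<open>At angle \<open>0\<close> the path \<open>U\<close> is \<open>XL\<close>, at
  \<open>pi/2\<close> it is the independent \<open>XR\<close>. The mean of
  \<open>F(XL) \<phi>(F(U s))\<close> thus moves from the mean of \<open>F \<phi>(F)\<close> to the
  product of the means, and its total change is minus the covariance. \<open>G_bounds\<close>
  controls the speed of this change.\<close>

theorem covariance_bounds:
  assumes l: "0 < l" and \<phi>: "\<And>x. (\<phi> has_real_derivative \<psi> x) (at x)"
    and \<psi>c: "continuous_on UNIV \<psi>" and \<psi>: "\<And>x. 0 \<le> \<psi> x" "\<And>x. \<psi> x \<le> C"
    and \<alpha>: "0 < \<alpha>" and Kb: "\<And>i j. i \<in> I \<Longrightarrow> j \<in> I \<Longrightarrow> \<alpha> \<le> K i j \<and> K i j \<le> \<beta>"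
  defines "cov \<equiv> (LINT \<omega>|M. smax l \<omega> * \<phi> (smax l \<omega>)) - (LINT \<omega>|M. smax l \<omega>) * (LINT \<omega>|M. \<phi> (smax l \<omega>))"
  shows "\<alpha> * (LINT \<omega>|M. \<psi> (smax l \<omega>)) \<le> cov" and "cov \<le> \<beta> * (LINT \<omega>|M. \<psi> (smax l \<omega>))"
proof -
  have C: "0 \<le> C" using \<psi>[of 0] by linarith
  have [measurable]: "\<psi> \<in> borel_measurable borel"
    by (rule borel_measurable_continuous_onI[OF \<psi>c])
  have "continuous_on UNIV \<phi>"
    using \<phi> by (intro continuous_at_imp_continuous_on ballI DERIV_isCont) auto
  then have [measurable]: "\<phi> \<in> borel_measurable borel"
    by (rule borel_measurable_continuous_onI)
  have lip: "\<bar>\<phi> x - \<phi> 0\<bar> \<le> C * \<bar>x\<bar>" for x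
    using field_differentiable_bound[of UNIV \<phi> \<psi> C x 0] \<phi> \<psi> by simp
  have \<phi>_le: "\<bar>\<phi> x\<bar> \<le> C * \<bar>x\<bar> + \<bar>\<phi> 0\<bar>" for x
    using lip[of x] by linarith
  let ?F = "smax l"
  have [measurable]: "?F \<in> borel_measurable M" by measurable
  have F2: "integrable M (\<lambda>\<omega>. (?F \<omega>)\<^sup>2)" by (rule smax_sq[OF l])
  have \<phi>F2: "integrable M (\<lambda>\<omega>. (\<phi> (?F \<omega>))\<^sup>2)"
  proof (rule integrable_square_bound)
    show "integrable M (\<lambda>\<omega>. (C * \<bar>?F \<omega>\<bar> + \<bar>\<phi> 0\<bar>)\<^sup>2)"
      using F2 by (intro integrable_add_square) (auto simp: power_mult_distrib)
    show "\<bar>\<phi> (?F \<omega>)\<bar> \<le> C * \<bar>?F \<omega>\<bar> + \<bar>\<phi> 0\<bar>" for \<omega> by (rule \<phi>_le)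
  qed measurable
  have iF: "integrable M ?F" by (rule square_integrable_imp_integrable[OF _ F2]) measurable
  have i\<phi>F: "integrable M (\<lambda>\<omega>. \<phi> (?F \<omega>))" by (rule square_integrable_imp_integrable[OF _ \<phi>F2]) measurable
  have iF\<phi>F: "integrable M (\<lambda>\<omega>. ?F \<omega> * \<phi> (?F \<omega>))"
    by (intro integrable_mult_of_squares F2 \<phi>F2) measurable
  interpret Q: pair_sigma_finite P lborel ..
  \<comment> \<open>Two forms of the same integrand: the sum of \<open>G\<close> terms in
    \<open>(U, V)\<close> is what \<open>rotation\<close> acts on, while the form with
    \<open>?F (fst \<omega>)\<close> pulled out is the path derivative needed for the fundamental
    theorem of calculus.\<close>
  define h where "h \<omega> s = (\<Sum>i\<in>I. G l \<psi> s i (U s \<omega>) (V s \<omega>)) * indicator {0..pi/2} s" for \<omega> s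
  have h: "h \<omega> s = ?F (fst \<omega>) * ((\<psi> (softmax l I (U s \<omega>)) * (\<Sum>i\<in>I. softmax_weight l I (U s \<omega>) i * V s \<omega> i)) * indicator {0..pi/2} s)" for \<omega> s
    unfolding h_def G_def UV_cancel by (simp add: sum_distrib_left sum_distrib_right mult_ac)
  have pw: "(LINT s|lborel. h \<omega> s) = ?F (fst \<omega>) * \<phi> (?F (snd \<omega>)) - ?F (fst \<omega>) * \<phi> (?F (fst \<omega>))" for \<omega>
  proof -
    have "(LINT s|lborel. h \<omega> s) = ?F (fst \<omega>) * (\<phi> (softmax l I (U (pi/2) \<omega>)) - \<phi> (softmax l I (U 0 \<omega>)))"
      unfolding h integral_mult_right_zero
      by (subst integral_FTC_Icc_real[where F = "\<lambda>s. \<phi> (softmax l I (U s \<omega>))"])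
         (auto intro!: path_derivative isCont_path_derivative l \<phi> \<psi>c)
    moreover have "U (pi/2) \<omega> = XR \<omega>" "U 0 \<omega> = XL \<omega>" by (simp_all add: U_def fun_eq_iff)
    ultimately show ?thesis by (simp add: right_diff_distrib)
  qed
  \<comment> \<open>A bound on \<open>h\<close> that is uniform in the angle, so that Fubini can
    exchange the angle with the expectation.\<close>
  define B where "B \<omega> = C * (?F (fst \<omega>) * (\<Sum>i\<in>I. \<bar>XL \<omega> i\<bar> + \<bar>XR \<omega> i\<bar>))" for \<omega>
  have iB: "integrable P B"
  proof -
    have "integrable P (\<lambda>\<omega>. (?F (fst \<omega>))\<^sup>2)"
      using P.integrable_mult_pair[OF F2, of "\<lambda>_. 1"] by simp
    moreover have "integrable P (\<lambda>\<omega>. (\<Sum>i\<in>I. \<bar>XL \<omega> i\<bar> + \<bar>XR \<omega> i\<bar>)\<^sup>2)"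
      by (intro integrable_sum_square integrable_add_square) (auto simp: integrable_XLR)
    ultimately show ?thesis unfolding B_def
      by (intro integrable_mult_right integrable_mult_of_squares) measurable
  qed
  have V_le: "\<bar>V s \<omega> i\<bar> \<le> \<bar>XL \<omega> i\<bar> + \<bar>XR \<omega> i\<bar>" for s \<omega> i
  proof -
    have "\<bar>- sin s * XL \<omega> i\<bar> \<le> 1 * \<bar>XL \<omega> i\<bar>" "\<bar>cos s * XR \<omega> i\<bar> \<le> 1 * \<bar>XR \<omega> i\<bar>"
      unfolding abs_mult by (intro mult_right_mono; simp)+
    then show ?thesis unfolding V_def by linarith
  qed
  have sw: "\<bar>softmax_weight l I x i\<bar> \<le> 1" if "i \<in> I" for x i
    using softmax_weight_le_1[OF fin that, of l x] softmax_weight_nonneg[of l I x i] by simp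
  have ih: "integrable (P \<Otimes>\<^sub>M lborel) (\<lambda>(\<omega>, s). h \<omega> s)"
  proof (rule Bochner_Integration.integrable_bound)
    have "integrable lborel (\<lambda>s. indicator {0..pi/2} s :: real)" by simp
    from Q.integrable_mult_pair[OF iB this]
    show "integrable (P \<Otimes>\<^sub>M lborel) (\<lambda>x. B (fst x) * indicator {0..pi/2} (snd x))" .
    show "(\<lambda>(\<omega>, s). h \<omega> s) \<in> borel_measurable (P \<Otimes>\<^sub>M lborel)"
      unfolding h U_def V_def by measurable
    have "\<bar>h \<omega> s\<bar> \<le> \<bar>B \<omega> * indicator {0..pi/2} s\<bar>" for \<omega> s
    proof -
      have "\<bar>\<Sum>i\<in>I. softmax_weight l I (U s \<omega>) i * V s \<omega> i\<bar> \<le> (\<Sum>i\<in>I. \<bar>softmax_weight l I (U s \<omega>) i * V s \<omega> i\<bar>)"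
        by (rule sum_abs)
      also have "\<dots> \<le> (\<Sum>i\<in>I. 1 * (\<bar>XL \<omega> i\<bar> + \<bar>XR \<omega> i\<bar>))"
        unfolding abs_mult using V_le sw by (intro sum_mono mult_mono) auto
      finally have "\<bar>\<psi> (softmax l I (U s \<omega>))\<bar> * \<bar>\<Sum>i\<in>I. softmax_weight l I (U s \<omega>) i * V s \<omega> i\<bar> \<le> C * \<bar>\<Sum>i\<in>I. (\<bar>XL \<omega> i\<bar> + \<bar>XR \<omega> i\<bar>)\<bar>"
        using \<psi> C by (intro mult_mono) (auto intro: order_trans[OF _ abs_ge_self])
      then have "\<bar>?F (fst \<omega>)\<bar> * (\<bar>\<psi> (softmax l I (U s \<omega>))\<bar> * \<bar>\<Sum>i\<in>I. softmax_weight l I (U s \<omega>) i * V s \<omega> i\<bar>)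
         \<le> \<bar>?F (fst \<omega>)\<bar> * (C * \<bar>\<Sum>i\<in>I. (\<bar>XL \<omega> i\<bar> + \<bar>XR \<omega> i\<bar>)\<bar>)"
        by (rule mult_left_mono) simp
      then show ?thesis using C unfolding h B_def abs_mult by (auto simp: indicator_def mult_ac)
    qed
    then show "AE x in P \<Otimes>\<^sub>M lborel. norm (case x of (\<omega>, s) \<Rightarrow> h \<omega> s) \<le> norm (B (fst x) * indicator {0..pi/2} (snd x))"
      by (auto simp: split_beta)
  qed
  have "(LINT \<omega>|P. LINT s|lborel. h \<omega> s) = (LINT \<omega>|P. ?F (fst \<omega>) * \<phi> (?F (snd \<omega>))) - (LINT \<omega>|P. ?F (fst \<omega>) * \<phi> (?F (fst \<omega>)))"
    unfolding pw
    using P.integrable_mult_pair[OF iF i\<phi>F] P.integrable_mult_pair[OF iF\<phi>F, of "\<lambda>_. 1"] by simp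
  also have "\<dots> = - cov"
    using P.integral_mult_pair[OF iF i\<phi>F] P.integral_mult_pair[OF iF\<phi>F, of "\<lambda>_. 1"]
    by (simp add: cov_def prob_space)
  finally have cov: "cov = (LINT s|lborel. - (LINT \<omega>|P. h \<omega> s))"
    using Q.Fubini_integral[OF ih] by simp
  have ics: "integrable lborel (\<lambda>s. - (LINT \<omega>|P. h \<omega> s))"
    using Q.integrable_snd[OF ih] by simp
  let ?w = "\<lambda>i. LINT \<omega>|M. \<psi> (?F \<omega>) * softmax_weight l I (\<lambda>i. X i \<omega>) i"
  \<comment> \<open>Since the softmax weights sum to one, the bounds for the single coordinates add
    up to a bound by the expectation of \<open>\<psi>\<close> alone.\<close>
  have w: "(\<Sum>i\<in>I. ?w i) = (LINT \<omega>|M. \<psi> (?F \<omega>))"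
  proof -
    have "integrable M (\<lambda>\<omega>. \<psi> (?F \<omega>) * softmax_weight l I (\<lambda>i. X i \<omega>) i)" if "i \<in> I" for i
    proof (rule integrable_const_bound[where B = "C * 1"])
      have "\<bar>\<psi> (?F \<omega>) * softmax_weight l I (\<lambda>i. X i \<omega>) i\<bar> \<le> C * 1" for \<omega>
        unfolding abs_mult using \<psi> C softmax_weight_le_1[OF fin that, of l "\<lambda>i. X i \<omega>"] softmax_weight_nonneg[of l I "\<lambda>i. X i \<omega>" i]
        by (intro mult_mono) auto
      then show "AE \<omega> in M. norm (\<psi> (?F \<omega>) * softmax_weight l I (\<lambda>i. X i \<omega>) i) \<le> C * 1" by simp
    qed (use that in measurable)
    then have "(\<Sum>i\<in>I. ?w i) = (LINT \<omega>|M. (\<Sum>i\<in>I. \<psi> (?F \<omega>) * softmax_weight l I (\<lambda>i. X i \<omega>) i))"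
      by (subst Bochner_Integration.integral_sum) auto
    then show ?thesis by (simp add: sum_distrib_left[symmetric] sum_softmax_weight[OF fin ne])
  qed
  have hs: "- (LINT \<omega>|P. h \<omega> s) = (\<Sum>i\<in>I. - (LINT \<omega>|P. G l \<psi> s i (XL \<omega>) (XR \<omega>))) * indicator {0..pi/2} s" for s
  proof -
    have "integrable P (\<lambda>\<omega>. G l \<psi> s i (U s \<omega>) (V s \<omega>))" if "i \<in> I" for i
      by (rule integrable_G[OF that _ \<psi> l]) (simp_all add: integrable_UV)
    then show ?thesis unfolding h_def by (simp add: rotation sum_negf)
  qed
  have s0: "0 \<le> sin s" if "s \<in> {0..pi/2}" for s
    using that by (intro sin_ge_zero) auto
  have lo: "(\<alpha> * (LINT \<omega>|M. \<psi> (?F \<omega>))) * (sin s * indicator {0..pi/2} s) \<le> - (LINT \<omega>|P. h \<omega> s)" for s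
  proof (cases "s \<in> {0..pi/2}")
    case True
    have "(\<Sum>i\<in>I. sin s * \<alpha> * ?w i) \<le> (\<Sum>i\<in>I. - (LINT \<omega>|P. G l \<psi> s i (XL \<omega>) (XR \<omega>)))"
      by (intro sum_mono, rule G_bounds(1)[where C = C and \<alpha> = \<alpha> and \<beta> = \<beta>])
         (auto intro: \<psi> l s0[OF True] \<alpha> simp: Kb)
    then show ?thesis using True unfolding hs sum_distrib_left[symmetric] w by (simp add: mult_ac)
  qed (simp add: hs)
  have hi: "- (LINT \<omega>|P. h \<omega> s) \<le> (\<beta> * (LINT \<omega>|M. \<psi> (?F \<omega>))) * (sin s * indicator {0..pi/2} s)" for s
  proof (cases "s \<in> {0..pi/2}")
    case True
    have "(\<Sum>i\<in>I. - (LINT \<omega>|P. G l \<psi> s i (XL \<omega>) (XR \<omega>))) \<le> (\<Sum>i\<in>I. sin s * \<beta> * ?w i)"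
      by (intro sum_mono, rule G_bounds(2)[where C = C and \<alpha> = \<alpha> and \<beta> = \<beta>])
         (auto intro: \<psi> l s0[OF True] \<alpha> simp: Kb)
    then show ?thesis using True unfolding hs sum_distrib_left[symmetric] w by (simp add: mult_ac)
  qed (simp add: hs)
  \<comment> \<open>The sine integrates to 1 over the quarter turn, so \<open>\<alpha>\<close> and
    \<open>\<beta>\<close> come out without a numerical factor.\<close>
  have sin: "has_bochner_integral lborel (\<lambda>s. sin s * indicator {0..pi/2} s) (- cos (pi/2) - - cos 0 :: real)"
    by (rule has_bochner_integral_FTC_Icc_real) (auto intro!: derivative_eq_intros)
  have isin: "integrable lborel (\<lambda>s. c * (sin s * indicator {0..pi/2} s))" for c :: real
    using sin by (auto simp: has_bochner_integral_iff)
  have int_sin: "(LINT s|lborel. c * (sin s * indicator {0..pi/2} s)) = c" for c :: real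
    using sin by (simp add: has_bochner_integral_iff)
  show "\<alpha> * (LINT \<omega>|M. \<psi> (?F \<omega>)) \<le> cov"
    using integral_mono[OF isin ics lo] unfolding int_sin cov .
  show "cov \<le> \<beta> * (LINT \<omega>|M. \<psi> (?F \<omega>))"
    using integral_mono[OF ics isin hi] unfolding int_sin cov .
qed

end

section \<open>Densities from two-sided Stein inequalities\<close>

text \<open>Half-open intervals are the differences of the tails \<open>{x<..}\<close> used
  below.\<close>

lemma integral_id_Ioc:
  fixes x y :: real
  assumes "0 \<le> x" "x \<le> y"
  shows "integrable lborel (\<lambda>z. z * indicator {x<..y} z :: real)"
    and "(LINT z|lborel. z * indicator {x<..y} z) = (y\<^sup>2 - x\<^sup>2) / 2"
proof -
  have "has_bochner_integral lborel (\<lambda>z. z * indicator {x..y} z) (y\<^sup>2 / 2 - x\<^sup>2 / 2)"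
    using assms by (intro has_bochner_integral_FTC_Icc_nonneg) (auto intro!: derivative_eq_intros)
  moreover have "AE z in lborel. z * indicator {x..y} z = (z * indicator {x<..y} z :: real)"
    using AE_lborel_singleton[of x] by eventually_elim (auto simp: indicator_def)
  ultimately have "has_bochner_integral lborel (\<lambda>z. z * indicator {x<..y} z) (y\<^sup>2 / 2 - x\<^sup>2 / 2)"
    by (subst has_bochner_integral_cong_AE[of _ _ "\<lambda>z. z * indicator {x..y} z"]) auto
  then show "integrable lborel (\<lambda>z. z * indicator {x<..y} z :: real)"
    "(LINT z|lborel. z * indicator {x<..y} z) = (y\<^sup>2 - x\<^sup>2) / 2"
    by (auto simp: has_bochner_integral_iff diff_divide_distrib)
qed

text \<open>
  As \<open>\<rho>\<close> is only measurable, the Gronwall argument for \<open>h' = - x \<rho>\<close> is carried out on the grid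
  \<open>x sqrt (k / n)\<close>, on which the squares are equally spaced.
\<close>

lemma tail_integral_gauss_bounds:
  fixes \<rho> :: "real \<Rightarrow> real" and \<alpha> \<beta> x :: real
  assumes [measurable]: "\<rho> \<in> borel_measurable borel"
    and int: "integrable lborel (\<lambda>z. z * \<rho> z * indicator {0<..} z)"
    and nonneg: "\<And>z. 0 \<le> \<rho> z" and \<alpha>: "0 < \<alpha>" and \<beta>: "0 < \<beta>"
  defines "h \<equiv> \<lambda>x. LINT z|lborel. z * \<rho> z * indicator {x<..} z"
  assumes bd: "AE z in lborel. 0 < z \<longrightarrow> \<alpha> * \<rho> z \<le> h z \<and> h z \<le> \<beta> * \<rho> z"
    and x: "0 \<le> x"
  shows "h 0 * exp (- (x\<^sup>2 / (2 * \<alpha>))) \<le> h x" and "h x \<le> h 0 * exp (- (x\<^sup>2 / (2 * \<beta>)))"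
proof -
  have inth: "integrable lborel (\<lambda>z. z * \<rho> z * indicator {x<..} z)" if "0 \<le> x" for x
    by (rule Bochner_Integration.integrable_bound[OF int]) (use that in \<open>auto simp: indicator_def\<close>)
  have intr: "integrable lborel (\<lambda>z. z * \<rho> z * indicator {x<..y} z)" if "0 \<le> x" for x y
    by (rule Bochner_Integration.integrable_bound[OF int]) (use that in \<open>auto simp: indicator_def\<close>)
  have hdiff: "h x - h y = (LINT z|lborel. z * \<rho> z * indicator {x<..y} z)" if "0 \<le> x" "x \<le> y" for x y
  proof -
    have "h x = (LINT z|lborel. z * \<rho> z * indicator {x<..y} z + z * \<rho> z * indicator {y<..} z)"
      unfolding h_def by (intro Bochner_Integration.integral_cong refl) (use that in \<open>auto simp: indicator_def\<close>)
    also have "\<dots> = (LINT z|lborel. z * \<rho> z * indicator {x<..y} z) + h y"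
      unfolding h_def using that by (intro Bochner_Integration.integral_add intr inth) auto
    finally show ?thesis by simp
  qed
  have anti: "h y \<le> h x" if "0 \<le> x" "x \<le> y" for x y
  proof -
    have "0 \<le> (LINT z|lborel. z * \<rho> z * indicator {x<..y} z)"
      using that nonneg by (intro integral_nonneg_AE) (auto simp: indicator_def)
    then show ?thesis using hdiff[OF that] by simp
  qed
  \<comment> \<open>On \<open>{x<..y}\<close> the density is at most \<open>h z / \<alpha>\<close>,
    hence at most \<open>h x / \<alpha>\<close> as \<open>h\<close> decreases. Freezing
    \<open>h\<close> at the left end gives an explicit Euler step in the variable
    \<open>x^2 / 2\<close>.\<close>
  have up: "h x * (1 - (y\<^sup>2 - x\<^sup>2) / (2 * \<alpha>)) \<le> h y" if xy: "0 \<le> x" "x \<le> y" for x y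
  proof -
    have "h x - h y \<le> (LINT z|lborel. (h x / \<alpha>) * (z * indicator {x<..y} z))"
      unfolding hdiff[OF xy]
    proof (rule integral_mono_AE)
      show "AE z in lborel. z * \<rho> z * indicator {x<..y} z \<le> (h x / \<alpha>) * (z * indicator {x<..y} z)"
        using bd
      proof eventually_elim
        case (elim z)
        have "z * \<rho> z \<le> (h x / \<alpha>) * z" if "z \<in> {x<..y}"
        proof -
          have "\<alpha> * \<rho> z \<le> h x" using elim that xy anti[of x z] by auto
          then have "\<rho> z \<le> h x / \<alpha>" using \<alpha> by (simp add: field_simps)
          then have "\<rho> z * z \<le> (h x / \<alpha>) * z" using that xy by (intro mult_right_mono) auto
          then show ?thesis by (simp only: mult.commute)
        qed
        then show ?case by (auto simp: indicator_def)
      qed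
    qed (use intr[OF xy(1)] integral_id_Ioc[OF xy] in \<open>auto simp del: times_divide_eq_left\<close>)
    also have "\<dots> = (h x / \<alpha>) * ((y\<^sup>2 - x\<^sup>2) / 2)"
      unfolding integral_mult_right_zero integral_id_Ioc(2)[OF xy] ..
    also have "\<dots> = h x * ((y\<^sup>2 - x\<^sup>2) / (2 * \<alpha>))" by simp
    finally show ?thesis unfolding right_diff_distrib[of "h x" 1] by simp
  qed
  \<comment> \<open>Here \<open>h\<close> is frozen at the right end, which bounds the density below
    by \<open>h y / \<beta>\<close> and gives an implicit Euler step.\<close>
  have lo: "h y * (1 + (y\<^sup>2 - x\<^sup>2) / (2 * \<beta>)) \<le> h x" if xy: "0 \<le> x" "x \<le> y" for x y
  proof -
    have "(LINT z|lborel. (h y / \<beta>) * (z * indicator {x<..y} z)) \<le> h x - h y"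
      unfolding hdiff[OF xy]
    proof (rule integral_mono_AE)
      show "AE z in lborel. (h y / \<beta>) * (z * indicator {x<..y} z) \<le> z * \<rho> z * indicator {x<..y} z"
        using bd
      proof eventually_elim
        case (elim z)
        have "(h y / \<beta>) * z \<le> z * \<rho> z" if "z \<in> {x<..y}"
        proof -
          have "h y \<le> \<beta> * \<rho> z" using elim that xy anti[of z y] by auto
          then have "h y / \<beta> \<le> \<rho> z" using \<beta> by (simp add: field_simps)
          then have "(h y / \<beta>) * z \<le> \<rho> z * z" using that xy by (intro mult_right_mono) auto
          then show ?thesis by (simp only: mult.commute)
        qed
        then show ?case by (auto simp: indicator_def)
      qed
    qed (use intr[OF xy(1)] integral_id_Ioc[OF xy] in \<open>auto simp del: times_divide_eq_left\<close>)
    moreover have "(LINT z|lborel. (h y / \<beta>) * (z * indicator {x<..y} z)) = (h y / \<beta>) * ((y\<^sup>2 - x\<^sup>2) / 2)"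
      unfolding integral_mult_right_zero integral_id_Ioc(2)[OF xy] ..
    moreover have "(h y / \<beta>) * ((y\<^sup>2 - x\<^sup>2) / 2) = h y * ((y\<^sup>2 - x\<^sup>2) / (2 * \<beta>))" by simp
    ultimately show ?thesis unfolding distrib_left[of "h y" 1] by simp
  qed
  define t where "t n k = x * sqrt (real k / real n)" for n k :: nat
  have t0: "0 \<le> t n k" for n k using x by (simp add: t_def)
  have t_mono: "t n k \<le> t n (Suc k)" for n k
    unfolding t_def using x by (intro mult_left_mono real_sqrt_le_mono divide_right_mono) auto
  have t_sq: "(t n (Suc k))\<^sup>2 - (t n k)\<^sup>2 = x\<^sup>2 / n" for n k
    by (simp add: t_def power_mult_distrib right_diff_distrib[symmetric] diff_divide_distrib[symmetric])
  have tz: "t n 0 = 0" for n by (simp add: t_def)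
  have tn: "t n n = x" if "0 < n" for n using that by (simp add: t_def)
  have up_pow: "h 0 * (1 + (- (x\<^sup>2 / (2 * \<alpha>))) / n) ^ k \<le> h (t n k)" if "0 \<le> 1 + (- (x\<^sup>2 / (2 * \<alpha>))) / real n" for n k :: nat
  proof (induction k)
    case (Suc k)
    let ?q = "1 + (- (x\<^sup>2 / (2 * \<alpha>))) / real n"
    have "h 0 * ?q ^ Suc k \<le> h (t n k) * (1 + (- (x\<^sup>2 / (2 * \<alpha>))) / n)"
      using mult_right_mono[OF Suc that] by (simp add: mult_ac)
    also have "h (t n k) * ?q \<le> h (t n (Suc k))"
      using up[OF t0 t_mono, of n k] unfolding t_sq by (simp add: mult_ac)
    finally show ?case .
  qed (simp add: tz)
  have lo_pow: "h (t n k) * (1 + (x\<^sup>2 / (2 * \<beta>)) / n) ^ k \<le> h 0" for n k :: nat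
  proof (induction k)
    case (Suc k)
    have p: "0 \<le> 1 + (x\<^sup>2 / (2 * \<beta>)) / n" using \<beta> by simp
    have "h (t n (Suc k)) * (1 + (x\<^sup>2 / (2 * \<beta>)) / n) \<le> h (t n k)"
      using lo[OF t0 t_mono, of n k] unfolding t_sq by (simp add: mult_ac)
    from mult_right_mono[OF this zero_le_power[OF p, of k]] Suc show ?case by (simp add: mult_ac)
  qed (simp add: tz)
  show "h 0 * exp (- (x\<^sup>2 / (2 * \<alpha>))) \<le> h x"
  proof (rule LIMSEQ_le_const2)
    show "(\<lambda>n. h 0 * (1 + (- (x\<^sup>2 / (2 * \<alpha>))) / real n) ^ n) \<longlonglongrightarrow> h 0 * exp (- (x\<^sup>2 / (2 * \<alpha>)))"
      by (intro tendsto_intros tendsto_exp_limit_sequentially)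
    show "\<exists>N. \<forall>n\<ge>N. h 0 * (1 + (- (x\<^sup>2 / (2 * \<alpha>))) / real n) ^ n \<le> h x"
    \<comment> \<open>Beyond this index the step factor is nonnegative, as the induction in
      \<open>up_pow\<close> requires; the added 1 keeps \<open>n\<close> positive.\<close>
    proof (intro exI[of _ "nat \<lceil>x\<^sup>2 / (2 * \<alpha>)\<rceil> + 1"] allI impI)
      fix n assume n: "nat \<lceil>x\<^sup>2 / (2 * \<alpha>)\<rceil> + 1 \<le> n"
      then have "x\<^sup>2 / (2 * \<alpha>) \<le> real n" "0 < n" by linarith+
      then have "(x\<^sup>2 / (2 * \<alpha>)) / real n \<le> 1" by (simp only: pos_divide_le_eq of_nat_0_less_iff mult_1)
      then have "0 \<le> 1 + (- (x\<^sup>2 / (2 * \<alpha>))) / real n" unfolding minus_divide_left[symmetric] by linarith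
      from up_pow[OF this, of n] show "h 0 * (1 + (- (x\<^sup>2 / (2 * \<alpha>))) / real n) ^ n \<le> h x"
        using tn[OF \<open>0 < n\<close>] by simp
    qed
  qed
  have "h x * exp (x\<^sup>2 / (2 * \<beta>)) \<le> h 0"
  proof (rule LIMSEQ_le_const2)
    show "(\<lambda>n. h x * (1 + (x\<^sup>2 / (2 * \<beta>)) / real n) ^ n) \<longlonglongrightarrow> h x * exp (x\<^sup>2 / (2 * \<beta>))"
      by (intro tendsto_intros tendsto_exp_limit_sequentially)
    show "\<exists>N. \<forall>n\<ge>N. h x * (1 + (x\<^sup>2 / (2 * \<beta>)) / real n) ^ n \<le> h 0"
      using lo_pow[of n n for n] tn by (intro exI[of _ 1]) (metis less_le_trans zero_less_one)
  qed
  then show "h x \<le> h 0 * exp (- (x\<^sup>2 / (2 * \<beta>)))"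
    by (simp add: exp_minus field_simps)
qed

text \<open>Prescribing \<open>\<phi> 0 = 0\<close> loses nothing, because the mean is zero and
  constants drop out of the middle term. For nondecreasing \<open>\<phi>\<close> it makes
  \<open>z * \<phi> z\<close> nonnegative, so that Tonelli's theorem applies.\<close>

locale stein_measure = prob_space \<mu> for \<mu> :: "real measure" +
  fixes \<alpha> \<beta> :: real
  assumes sets_\<mu>[measurable_cong]: "sets \<mu> = sets borel"
    and sq: "integrable \<mu> (\<lambda>z. z\<^sup>2)" and mean: "(LINT z|\<mu>. z) = 0"
    and \<alpha>: "0 < \<alpha>" and \<beta>: "0 < \<beta>"
    and stein: "\<And>\<phi> \<psi>. \<lbrakk>\<And>x. (\<phi> has_real_derivative \<psi> x) (at x); \<phi> 0 = 0; continuous_on UNIV \<psi>;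
        \<And>x. 0 \<le> \<psi> x; \<And>x. \<psi> x \<le> 1\<rbrakk> \<Longrightarrow>
      \<alpha> * (LINT z|\<mu>. \<psi> z) \<le> (LINT z|\<mu>. z * \<phi> z) \<and> (LINT z|\<mu>. z * \<phi> z) \<le> \<beta> * (LINT z|\<mu>. \<psi> z)"
begin

lemma space_\<mu>[simp]: "space \<mu> = UNIV"
  using sets_eq_imp_space_eq[OF sets_\<mu>] by simp

lemma integrable_id: "integrable \<mu> (\<lambda>z. z)"
  by (rule square_integrable_imp_integrable[OF _ sq]) measurable

text \<open>
  The kernel is chosen such that integrating \<open>\<psi> x kern x z\<close> over \<open>x\<close> gives \<open>z \<phi> z\<close> if \<open>\<phi>' = \<psi>\<close> and \<open>\<phi> 0 = 0\<close>.
  For \<open>x \<noteq> 0\<close>, \<open>H x\<close> is the integral of \<open>\<bar>z\<bar>\<close> over the tail beyond \<open>x\<close>.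
\<close>

definition kern :: "real \<Rightarrow> real \<Rightarrow> real" where
  "kern x z = (if min 0 z \<le> x \<and> x \<le> max 0 z then \<bar>z\<bar> else 0)"

definition H :: "real \<Rightarrow> real" where "H x = (LINT z|\<mu>. kern x z)"

lemma kern_nonneg: "0 \<le> kern x z" by (simp add: kern_def)

lemma measurable_kern[measurable]: "(\<lambda>(x, z). kern x z) \<in> borel_measurable (borel \<Otimes>\<^sub>M borel)"
  unfolding kern_def by measurable

lemma integrable_kern: "integrable \<mu> (kern x)"
proof (rule Bochner_Integration.integrable_bound[OF integrable_id])
  show "kern x \<in> borel_measurable \<mu>" by measurable
qed (simp add: kern_def)

lemma H_nonneg: "0 \<le> H x"
  unfolding H_def by (intro integral_nonneg_AE) (simp add: kern_nonneg)

lemma measurable_H[measurable]: "H \<in> borel_measurable borel"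
  unfolding H_def by measurable

lemma ennreal_H: "ennreal (H x) = (\<integral>\<^sup>+z. ennreal (kern x z) \<partial>\<mu>)"
  unfolding H_def using nn_integral_eq_integral[OF integrable_kern] kern_nonneg by simp

text \<open>Turns the middle term of the Stein inequalities into the integral of
  \<open>\<psi>\<close> against the measure with Lebesgue density \<open>H\<close>. From here on the
  inequalities compare this measure with \<open>\<mu>\<close>.\<close>

lemma has_integral_H:
  assumes \<phi>: "\<And>x. (\<phi> has_real_derivative \<psi> x) (at x)" "\<phi> 0 = 0" and \<psi>c: "continuous_on UNIV \<psi>"
    and \<psi>: "\<And>x. 0 \<le> \<psi> x" "\<And>x. \<psi> x \<le> 1"
  shows "has_bochner_integral lborel (\<lambda>x. \<psi> x * H x) (LINT z|\<mu>. z * \<phi> z)"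
proof (rule has_bochner_integral_nn_integral)
  have [measurable]: "\<psi> \<in> borel_measurable borel"
    by (rule borel_measurable_continuous_onI[OF \<psi>c])
  have "continuous_on UNIV \<phi>"
    using \<phi> by (intro continuous_at_imp_continuous_on ballI DERIV_isCont) auto
  then have [measurable]: "\<phi> \<in> borel_measurable borel"
    by (rule borel_measurable_continuous_onI)
  have lip: "\<bar>\<phi> x\<bar> \<le> \<bar>x\<bar>" for x
    using field_differentiable_bound[of UNIV \<phi> \<psi> 1 x 0] \<phi> \<psi> by simp
  have mono: "\<phi> x \<le> \<phi> y" if "x \<le> y" for x y
    using that by (rule DERIV_nonneg_imp_nondecreasing) (use \<phi>(1) \<psi>(1) in blast)
  have z\<phi>: "0 \<le> z * \<phi> z" for z
    using mono[of 0 z] mono[of z 0] \<phi>(2) by (cases "0 \<le> z") (auto intro: mult_nonpos_nonpos)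
  have i: "integrable \<mu> (\<lambda>z. z * \<phi> z)"
  proof (rule Bochner_Integration.integrable_bound[OF sq])
    have "\<bar>z * \<phi> z\<bar> \<le> z\<^sup>2" for z
      using mult_left_mono[OF lip[of z], of "\<bar>z\<bar>"] by (simp add: abs_mult power2_eq_square)
    then show "AE z in \<mu>. norm (z * \<phi> z) \<le> norm (z\<^sup>2)" by simp
  qed measurable
  interpret Q: pair_sigma_finite lborel \<mu> ..
  have inner: "(\<integral>\<^sup>+x. ennreal (\<psi> x) * ennreal (kern x z) \<partial>lborel) = ennreal (z * \<phi> z)" for z
  proof -
    have "(\<integral>\<^sup>+x. ennreal (\<psi> x) * ennreal (kern x z) \<partial>lborel) =
       (\<integral>\<^sup>+x. ennreal \<bar>z\<bar> * (ennreal (\<psi> x) * indicator {min 0 z..max 0 z} x) \<partial>lborel)"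
      by (intro nn_integral_cong) (auto simp: kern_def indicator_def mult.commute)
    also have "\<dots> = ennreal \<bar>z\<bar> * (\<integral>\<^sup>+x. ennreal (\<psi> x) * indicator {min 0 z..max 0 z} x \<partial>lborel)"
      by (rule nn_integral_cmult) measurable
    also have "(\<integral>\<^sup>+x. ennreal (\<psi> x) * indicator {min 0 z..max 0 z} x \<partial>lborel) = ennreal (\<phi> (max 0 z) - \<phi> (min 0 z))"
      using \<phi> \<psi> by (intro nn_integral_FTC_Icc) auto
    also have "ennreal \<bar>z\<bar> * \<dots> = ennreal (\<bar>z\<bar> * (\<phi> (max 0 z) - \<phi> (min 0 z)))"
      by (rule ennreal_mult[symmetric]) (auto simp: mono)
    also have "\<bar>z\<bar> * (\<phi> (max 0 z) - \<phi> (min 0 z)) = z * \<phi> z"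
      using \<phi>(2) by (auto simp: max_def min_def)
    finally show ?thesis .
  qed
  have "(\<integral>\<^sup>+x. ennreal (\<psi> x * H x) \<partial>lborel) = (\<integral>\<^sup>+x. \<integral>\<^sup>+z. ennreal (\<psi> x) * ennreal (kern x z) \<partial>\<mu> \<partial>lborel)"
    using \<psi> H_nonneg by (intro nn_integral_cong) (simp add: ennreal_mult ennreal_H nn_integral_cmult)
  also have "\<dots> = (\<integral>\<^sup>+z. \<integral>\<^sup>+x. ennreal (\<psi> x) * ennreal (kern x z) \<partial>lborel \<partial>\<mu>)"
    by (rule Q.Fubini'[symmetric]) measurable
  also have "\<dots> = ennreal (LINT z|\<mu>. z * \<phi> z)"
    unfolding inner using i z\<phi> by (intro nn_integral_eq_integral) auto
  finally show "(\<integral>\<^sup>+x. ennreal (\<psi> x * H x) \<partial>lborel) = ennreal (LINT z|\<mu>. z * \<phi> z)" .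
  show "AE x in lborel. 0 \<le> \<psi> x * H x" using \<psi> H_nonneg by simp
  show "0 \<le> (LINT z|\<mu>. z * \<phi> z)" using z\<phi> by (intro integral_nonneg_AE) simp
  show "(\<lambda>x. \<psi> x * H x) \<in> borel_measurable lborel" by measurable
qed

text \<open>The case \<open>\<psi> = 1\<close>: the total integral of \<open>H\<close> is the second
  moment of \<open>\<mu>\<close>.\<close>

lemma integrable_H: "integrable lborel H"
  using has_integral_H[of "\<lambda>x. x" "\<lambda>_. 1"] by (auto simp: has_bochner_integral_iff)

section \<open>Comparing the law with the measure of density \<open>H\<close>, from continuous
  functions to Borel sets\<close>

lemma sandwich_continuous:
  assumes \<psi>c: "continuous_on UNIV \<psi>" and \<psi>: "\<And>x. 0 \<le> \<psi> x" "\<And>x. \<psi> x \<le> 1"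
  shows "\<alpha> * (LINT z|\<mu>. \<psi> z) \<le> (LINT x|lborel. \<psi> x * H x)"
    and "(LINT x|lborel. \<psi> x * H x) \<le> \<beta> * (LINT z|\<mu>. \<psi> z)"
proof -
  have "\<exists>F. \<forall>x::real. -\<infinity> < ereal x \<longrightarrow> ereal x < \<infinity> \<longrightarrow> (F has_vector_derivative \<psi> x) (at x)"
    by (rule einterval_antiderivative) (use \<psi>c in \<open>auto simp: continuous_on_eq_continuous_at\<close>)
  then obtain F where F: "\<And>x. (F has_real_derivative \<psi> x) (at x)"
    by (auto simp: has_real_derivative_iff_has_vector_derivative)
  define \<phi> where "\<phi> x = F x - F 0" for x
  have \<phi>: "(\<phi> has_real_derivative \<psi> x) (at x)" "\<phi> 0 = 0" for x
    unfolding \<phi>_def by (auto intro!: derivative_eq_intros F)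
  show "\<alpha> * (LINT z|\<mu>. \<psi> z) \<le> (LINT x|lborel. \<psi> x * H x)"
    "(LINT x|lborel. \<psi> x * H x) \<le> \<beta> * (LINT z|\<mu>. \<psi> z)"
    using stein[OF \<phi> \<psi>c \<psi>] has_integral_H[OF \<phi> \<psi>c \<psi>] by (auto simp: has_bochner_integral_iff)
qed

lemma sandwich_compact:
  assumes K: "compact K"
  shows "\<alpha> * measure \<mu> K \<le> (LINT x|lborel. H x * indicator K x)"
    and "(LINT x|lborel. H x * indicator K x) \<le> \<beta> * measure \<mu> K"
proof -
  have "\<alpha> * measure \<mu> K \<le> (LINT x|lborel. H x * indicator K x) \<and> (LINT x|lborel. H x * indicator K x) \<le> \<beta> * measure \<mu> K"
  proof (cases "K = {}")
    case False
    have cl: "closed K" using K by (rule compact_imp_closed)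
    then have [measurable]: "K \<in> sets borel" by (rule borel_closed)
    \<comment> \<open>Continuous functions equal to 1 on \<open>K\<close> and, for positive
      \<open>n\<close>, equal to 0 at distance \<open>1/n\<close> or more; they decrease to the
      indicator because \<open>K\<close> is closed.\<close>
    define f where "f n x = max 0 (1 - real n * infdist x K)" for n x
    have fc: "continuous_on UNIV (f n)" for n
      unfolding f_def by (intro continuous_intros)
    then have [measurable]: "f n \<in> borel_measurable borel" for n
      by (rule borel_measurable_continuous_onI)
    have f: "0 \<le> f n x" "f n x \<le> 1" for n x by (auto simp: f_def infdist_nonneg)
    have lim: "(\<lambda>n. f n x) \<longlonglongrightarrow> indicator K x" for x
    proof (cases "x \<in> K")
      case True
      then show ?thesis by (simp add: f_def)
    next
      case False
      then have "0 < infdist x K"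
        using in_closed_iff_infdist_zero[OF cl \<open>K \<noteq> {}\<close>] infdist_nonneg[of x K] by force
      then obtain N where N: "1 < real N * infdist x K" using reals_Archimedean3 by blast
      have "f n x = 0" if "N \<le> n" for n
      proof -
        have "real N * infdist x K \<le> real n * infdist x K" using that by (intro mult_right_mono) (auto simp: infdist_nonneg)
        then show ?thesis using N by (simp add: f_def)
      qed
      then have "eventually (\<lambda>n. f n x = 0) sequentially" by (auto simp: eventually_sequentially)
      then show ?thesis using False by (simp add: tendsto_eventually)
    qed
    have l1: "(\<lambda>n. LINT z|\<mu>. f n z) \<longlonglongrightarrow> (LINT z|\<mu>. indicator K z)"
      by (rule integral_dominated_convergence[where w = "\<lambda>_. 1"]) (use f lim in auto)
    have l2: "(\<lambda>n. LINT x|lborel. f n x * H x) \<longlonglongrightarrow> (LINT x|lborel. indicator K x * H x)"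
    proof (rule integral_dominated_convergence[where w = H])
      show "AE x in lborel. (\<lambda>n. f n x * H x) \<longlonglongrightarrow> indicator K x * H x"
        by (intro AE_I2 tendsto_intros lim)
      show "AE x in lborel. norm (f n x * H x) \<le> H x" for n
        using f H_nonneg by (auto simp: abs_mult mult_left_le_one_le)
    qed (auto simp: integrable_H)
    have "\<alpha> * (LINT z|\<mu>. indicator K z) \<le> (LINT x|lborel. indicator K x * H x)"
      using sandwich_continuous(1)[OF fc f] by (intro LIMSEQ_le[OF tendsto_mult_left[OF l1] l2]) auto
    moreover have "(LINT x|lborel. indicator K x * H x) \<le> \<beta> * (LINT z|\<mu>. indicator K z)"
      using sandwich_continuous(2)[OF fc f] by (intro LIMSEQ_le[OF l2 tendsto_mult_left[OF l1]]) auto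
    ultimately show ?thesis by (simp add: mult.commute)
  qed simp
  then show "\<alpha> * measure \<mu> K \<le> (LINT x|lborel. H x * indicator K x)"
    "(LINT x|lborel. H x * indicator K x) \<le> \<beta> * measure \<mu> K" by auto
qed

definition \<nu> where "\<nu> = density lborel (\<lambda>x. ennreal (H x))"

lemma emeasure_\<nu>: 
  assumes [measurable]: "A \<in> sets borel"
  shows "emeasure \<nu> A = ennreal (LINT x|lborel. H x * indicator A x)"
proof -
  have "emeasure \<nu> A = (\<integral>\<^sup>+x. ennreal (H x * indicator A x) \<partial>lborel)"
    unfolding \<nu>_def by (subst emeasure_density) (auto intro!: nn_integral_cong simp: indicator_def)
  also have "\<dots> = ennreal (LINT x|lborel. H x * indicator A x)"
    using integrable_H H_nonneg by (intro nn_integral_eq_integral integrable_real_mult_indicator) auto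
  finally show ?thesis .
qed

text \<open>Both measures are finite Borel measures, hence inner regular. Each inequality
  approximates the measure on its smaller side by compact subsets of \<open>A\<close>:
  \<open>\<mu>\<close> for the first one, \<open>\<nu>\<close> for the second.\<close>

lemma sandwich:
  assumes A[measurable]: "A \<in> sets borel"
  shows "\<alpha> * measure \<mu> A \<le> (LINT x|lborel. H x * indicator A x)"
    and "(LINT x|lborel. H x * indicator A x) \<le> \<beta> * measure \<mu> A"
proof -
  have sn: "sets \<nu> = sets borel" by (simp add: \<nu>_def)
  then have spn: "space \<nu> = UNIV" using sets_eq_imp_space_eq by fastforce
  have nn: "0 \<le> (LINT x|lborel. H x * indicator B x)" for B
    using H_nonneg by (intro integral_nonneg_AE) (simp add: indicator_def)
  have fin: "emeasure \<nu> (space \<nu>) \<noteq> \<infinity>" "emeasure \<mu> (space \<mu>) \<noteq> \<infinity>"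
    unfolding spn by (simp_all add: emeasure_\<nu>)
  have cb: "K \<in> sets borel" if "compact K" for K :: "real set" using that by (simp add: compact_imp_closed)
  have "emeasure \<mu> A \<le> ennreal ((LINT x|lborel. H x * indicator A x) / \<alpha>)"
    unfolding inner_regular[OF sets_\<mu> fin(2) A]
  proof (intro SUP_least, clarsimp)
    fix K assume K: "K \<subseteq> A" "compact K"
    have "(LINT x|lborel. H x * indicator K x) \<le> (LINT x|lborel. H x * indicator A x)"
      using integrable_H H_nonneg K cb
      by (intro integral_mono integrable_real_mult_indicator) (auto simp: indicator_def)
    with sandwich_compact(1)[OF K(2)] have "\<alpha> * measure \<mu> K \<le> (LINT x|lborel. H x * indicator A x)" by linarith
    then show "emeasure \<mu> K \<le> ennreal ((LINT x|lborel. H x * indicator A x) / \<alpha>)"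
      using \<alpha> by (simp add: emeasure_eq_measure field_simps ennreal_leI)
  qed
  then show "\<alpha> * measure \<mu> A \<le> (LINT x|lborel. H x * indicator A x)"
    using \<alpha> nn[of A] by (simp add: emeasure_eq_measure field_simps)
  have "emeasure \<nu> A \<le> ennreal (\<beta> * measure \<mu> A)"
    unfolding inner_regular[OF sn fin(1) A]
  proof (intro SUP_least, clarsimp)
    fix K assume K: "K \<subseteq> A" "compact K"
    have "measure \<mu> K \<le> measure \<mu> A" using K by (intro finite_measure_mono) auto
    then have "\<beta> * measure \<mu> K \<le> \<beta> * measure \<mu> A" using \<beta> by (intro mult_left_mono) auto
    with sandwich_compact(2)[OF K(2)] show "emeasure \<nu> K \<le> ennreal (\<beta> * measure \<mu> A)"
      by (simp add: emeasure_\<nu> cb K ennreal_leI)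
  qed
  then show "(LINT x|lborel. H x * indicator A x) \<le> \<beta> * measure \<mu> A"
    using \<beta> by (simp add: emeasure_\<nu>)
qed

section \<open>The density and its Gaussian bounds\<close>

text \<open>The first half of \<open>sandwich\<close> makes Lebesgue null sets null for
  \<open>\<mu>\<close>, so Radon-Nikodym provides \<open>\<rho>\<close>; both halves then pass from
  sets to points almost everywhere. The quotient of \<open>H\<close> by \<open>\<rho>\<close> is the
  Stein kernel of the law.\<close>

lemma density_exists:
  obtains \<rho> where "\<rho> \<in> borel_measurable borel" "\<And>x. 0 \<le> \<rho> x" "\<mu> = density lborel (\<lambda>x. ennreal (\<rho> x))"
    "AE x in lborel. \<alpha> * \<rho> x \<le> H x \<and> H x \<le> \<beta> * \<rho> x"
proof -
  have ac: "absolutely_continuous lborel \<mu>"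
    unfolding absolutely_continuous_def
  proof
    fix A assume A: "A \<in> null_sets (lborel :: real measure)"
    then have Ab: "A \<in> sets borel" by auto
    have "AE x in lborel. H x * indicator A x = 0"
      using AE_not_in[OF A] by eventually_elim simp
    then have "(LINT x|lborel. H x * indicator A x) = 0" by (rule integral_eq_zero_AE)
    then have "measure \<mu> A = 0"
      using sandwich(1)[OF Ab] \<alpha> measure_nonneg[of \<mu> A] by (simp add: mult_le_0_iff)
    then show "A \<in> null_sets \<mu>" using Ab by (auto simp: null_sets_def emeasure_eq_measure sets_\<mu>)
  qed
  have s: "sets \<mu> = sets lborel" by (simp add: sets_\<mu>)
  obtain D where D[measurable]: "D \<in> borel_measurable lborel"
    and RN: "AE x in lborel. RN_deriv lborel \<mu> x = ennreal (D x)" and D0: "\<And>x. 0 \<le> D x"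
    using sigma_finite_measure.real_RN_deriv[OF sigma_finite_lborel, OF finite_measure_axioms ac s] by metis
  have d: "\<mu> = density lborel (\<lambda>x. ennreal (D x))"
    using sigma_finite_measure.density_RN_deriv[OF sigma_finite_lborel ac s] density_cong[OF _ _ RN] by simp
  have iD: "integrable lborel D"
  proof (rule integrableI_nonneg)
    have "(\<integral>\<^sup>+x. ennreal (D x) \<partial>lborel) = emeasure \<mu> (space \<mu>)"
      by (subst d) (simp add: emeasure_density)
    then show "(\<integral>\<^sup>+x. ennreal (D x) \<partial>lborel) < \<infinity>" by (simp add: less_top[symmetric])
  qed (simp_all add: D0)
  have m: "measure \<mu> A = (LINT x|lborel. D x * indicator A x)" if [measurable]: "A \<in> sets borel" for A
  proof -
    have "measure \<mu> A = (LINT x|\<mu>. indicator A x)" by simp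
    also have "\<dots> = (LINT x|lborel. D x *\<^sub>R indicator A x)"
      by (subst d, rule integral_density) (auto simp: D0)
    finally show ?thesis by simp
  qed
  have "AE x in lborel. \<alpha> * D x \<le> H x"
    using sandwich(1) by (intro AE_le_of_integral_le integrable_H integrable_mult_right iD) (simp add: m mult.assoc)
  moreover have "AE x in lborel. H x \<le> \<beta> * D x"
    using sandwich(2) by (intro AE_le_of_integral_le integrable_H integrable_mult_right iD) (simp add: m mult.assoc)
  ultimately have "AE x in lborel. \<alpha> * D x \<le> H x \<and> H x \<le> \<beta> * D x" by eventually_elim simp
  then show ?thesis using that[of D] D D0 d by simp
qed

text \<open>The tail estimate is applied to \<open>\<rho>\<close> on the positive half-line and to
  its mirror image for the negative one. Mean zero makes the positive and the negative part
  contribute equally to \<open>E|Z|\<close>, which is the source of the factor 2 in the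
  constants.\<close>

theorem density_gauss_bounds:
  "\<exists>\<rho>. \<rho> \<in> borel_measurable borel \<and> (\<forall>x. 0 \<le> \<rho> x) \<and> \<mu> = density lborel (\<lambda>x. ennreal (\<rho> x)) \<and>
    (AE z in lborel. (LINT x|\<mu>. \<bar>x\<bar>) / (2 * \<beta>) * exp (- (z\<^sup>2 / (2 * \<alpha>))) \<le> \<rho> z \<and>
       \<rho> z \<le> (LINT x|\<mu>. \<bar>x\<bar>) / (2 * \<alpha>) * exp (- (z\<^sup>2 / (2 * \<beta>))))"
proof -
  obtain \<rho> where [measurable]: "\<rho> \<in> borel_measurable borel" and \<rho>0: "\<And>x. 0 \<le> \<rho> x"
    and d: "\<mu> = density lborel (\<lambda>x. ennreal (\<rho> x))"
    and b: "AE x in lborel. \<alpha> * \<rho> x \<le> H x \<and> H x \<le> \<beta> * \<rho> x"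
    by (rule density_exists, rule that)
  have lint: "(LINT x|\<mu>. g x) = (LINT x|lborel. \<rho> x * g x)" if [measurable]: "g \<in> borel_measurable borel" for g :: "real \<Rightarrow> real"
    by (subst d, subst integral_density) (auto simp: \<rho>0)
  have lint': "integrable lborel (\<lambda>x. \<rho> x * g x)" if "integrable \<mu> g" for g :: "real \<Rightarrow> real"
  proof -
    have "g \<in> borel_measurable \<mu>" using that by (rule borel_measurable_integrable)
    then have [measurable]: "g \<in> borel_measurable borel" using measurable_cong_sets[OF sets_\<mu> refl] by blast
    have "integrable (density lborel (\<lambda>x. ennreal (\<rho> x))) g" using that unfolding d[symmetric] .
    then show ?thesis by (subst (asm) integrable_density) (auto simp: \<rho>0)
  qed
  define h where "h = (\<lambda>x. LINT z|lborel. z * \<rho> z * indicator {x<..} z)"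
  define h' where "h' = (\<lambda>x. LINT z|lborel. z * \<rho> (- z) * indicator {x<..} z)"
  have "integrable \<mu> (\<lambda>z. max 0 z)" "integrable \<mu> (\<lambda>z. max 0 (- z))"
    by (rule Bochner_Integration.integrable_bound[OF integrable_id]; auto)+
  note ii = this
  have eqp: "z * \<rho> z * indicator {0<..} z = \<rho> z * max 0 z" for z by (auto simp: indicator_def max_def)
  have eqn: "z * \<rho> (- z) * indicator {0<..} z = \<rho> (- z) * max 0 (- (- z))" for z by (auto simp: indicator_def max_def)
  have ip: "integrable lborel (\<lambda>z. z * \<rho> z * indicator {0<..} z)"
    unfolding eqp by (rule lint'[OF ii(1)])
  have in': "integrable lborel (\<lambda>z. z * \<rho> (- z) * indicator {0<..} z)"
    unfolding eqn using lborel_integrable_real_affine[OF lint'[OF ii(2)], of "-1" 0] by simp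
  have h0: "h 0 = (LINT z|\<mu>. max 0 z)" unfolding h_def eqp by (simp add: lint)
  have h'0: "h' 0 = (LINT z|\<mu>. max 0 (- z))"
    unfolding h'_def eqn using lborel_integral_real_affine[of "-1" "\<lambda>z. \<rho> z * max 0 (- z)" 0] by (simp add: lint)
  have "(LINT z|\<mu>. max 0 z) - (LINT z|\<mu>. max 0 (- z)) = (LINT z|\<mu>. max 0 z - max 0 (- z))" using ii by simp
  also have "\<dots> = 0" using mean by (subst Bochner_Integration.integral_cong[OF refl, where g = "\<lambda>z. z"]) auto
  finally have e1: "h 0 = h' 0" by (simp add: h0 h'0)
  have "(LINT z|\<mu>. max 0 z) + (LINT z|\<mu>. max 0 (- z)) = (LINT z|\<mu>. max 0 z + max 0 (- z))" using ii by simp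
  also have "\<dots> = (LINT z|\<mu>. \<bar>z\<bar>)" by (intro Bochner_Integration.integral_cong) auto
  finally have e2: "h 0 = (LINT z|\<mu>. \<bar>z\<bar>) / 2" "h' 0 = (LINT z|\<mu>. \<bar>z\<bar>) / 2" using e1 by (simp_all add: h0 h'0)
  have Hp: "H x = h x" if "0 < x" for x
  proof -
    have "H x = (LINT z|lborel. \<rho> z * kern x z)" unfolding H_def by (rule lint) measurable
    also have "\<dots> = h x" unfolding h_def
    proof (rule integral_cong_AE)
      \<comment> \<open>\<open>kern x\<close> includes the point \<open>z = x\<close>, the open tail
        in \<open>h\<close> does not; the difference is a null set.\<close>
      show "AE z in lborel. \<rho> z * kern x z = z * \<rho> z * indicator {x<..} z"
        using AE_lborel_singleton[of x] by eventually_elim (use that in \<open>auto simp: kern_def indicator_def\<close>)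
    qed measurable
    finally show ?thesis .
  qed
  have Hn: "H (- x) = h' x" if "0 < x" for x
  proof -
    have "H (- x) = (LINT z|lborel. \<rho> z * kern (- x) z)" unfolding H_def by (rule lint) measurable
    also have "\<dots> = (LINT z|lborel. \<rho> (- z) * kern (- x) (- z))"
      using lborel_integral_real_affine[of "-1" "\<lambda>z. \<rho> z * kern (- x) z" 0] by simp
    also have "\<dots> = h' x" unfolding h'_def
    proof (rule integral_cong_AE)
      show "AE z in lborel. \<rho> (- z) * kern (- x) (- z) = z * \<rho> (- z) * indicator {x<..} z"
        using AE_lborel_singleton[of x] by eventually_elim (use that in \<open>auto simp: kern_def indicator_def\<close>)
    qed measurable
    finally show ?thesis .
  qed
  have AE_uminus: "AE z in lborel. P (- z)" if "AE z in lborel. P z" "Measurable.pred borel P" for P :: "real \<Rightarrow> bool"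
  proof -
    have "AE z in distr lborel borel uminus. P z" unfolding lborel_distr_uminus by (rule that(1))
    then show ?thesis using that(2) by (subst (asm) AE_distr_iff) (auto simp: pred_def)
  qed
  have bn: "AE x in lborel. \<alpha> * \<rho> (- x) \<le> H (- x) \<and> H (- x) \<le> \<beta> * \<rho> (- x)"
    by (rule AE_uminus[OF b]) measurable
  have bp: "AE z in lborel. 0 < z \<longrightarrow> \<alpha> * \<rho> z \<le> h z \<and> h z \<le> \<beta> * \<rho> z"
    using b by eventually_elim (auto simp: Hp)
  have bn': "AE z in lborel. 0 < z \<longrightarrow> \<alpha> * \<rho> (- z) \<le> h' z \<and> h' z \<le> \<beta> * \<rho> (- z)"
    using bn by eventually_elim (auto simp: Hn)
  have tp: "h 0 * exp (- (x\<^sup>2 / (2 * \<alpha>))) \<le> h x" "h x \<le> h 0 * exp (- (x\<^sup>2 / (2 * \<beta>)))" if "0 \<le> x" for x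
    using tail_integral_gauss_bounds[of \<rho>, OF _ ip \<rho>0 \<alpha> \<beta> bp[unfolded h_def] that] by (simp_all add: h_def)
  have tn: "h' 0 * exp (- (x\<^sup>2 / (2 * \<alpha>))) \<le> h' x" "h' x \<le> h' 0 * exp (- (x\<^sup>2 / (2 * \<beta>)))" if "0 \<le> x" for x
    using tail_integral_gauss_bounds[of "\<lambda>z. \<rho> (- z)", OF _ in' \<rho>0 \<alpha> \<beta> bn'[unfolded h'_def] that] by (simp_all add: h'_def)
  let ?E = "LINT x|\<mu>. \<bar>x\<bar>"
  \<comment> \<open>The origin has to be left out: \<open>kern 0 z\<close> is
    \<open>\<bar>z\<bar>\<close> for every \<open>z\<close>, so \<open>H 0\<close> collects both
    tails and equals \<open>?E\<close> instead of \<open>?E / 2\<close>.\<close>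
  have G: "?E / 2 * exp (- (z\<^sup>2 / (2 * \<alpha>))) \<le> H z \<and> H z \<le> ?E / 2 * exp (- (z\<^sup>2 / (2 * \<beta>)))" if "z \<noteq> 0" for z
  proof (cases "0 < z")
    case True
    then show ?thesis using tp[of z] by (simp add: Hp e2)
  next
    case False
    then show ?thesis using tn[of "- z"] Hn[of "- z"] that by (simp add: e2)
  qed
  have "AE z in lborel. ?E / (2 * \<beta>) * exp (- (z\<^sup>2 / (2 * \<alpha>))) \<le> \<rho> z \<and>
       \<rho> z \<le> ?E / (2 * \<alpha>) * exp (- (z\<^sup>2 / (2 * \<beta>)))"
    using b AE_lborel_singleton[of 0]
  proof eventually_elim
    case (elim z)
    have "?E / 2 * exp (- (z\<^sup>2 / (2 * \<alpha>))) \<le> \<beta> * \<rho> z" "\<alpha> * \<rho> z \<le> ?E / 2 * exp (- (z\<^sup>2 / (2 * \<beta>)))"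
      using G[of z] elim by auto
    then show ?case using \<alpha> \<beta> by (simp add: field_simps)
  qed
  then show ?thesis using \<rho>0 d by (intro exI[of _ \<rho>]) auto
qed

end

section \<open>The supremum of fractional Brownian motion\<close>

lemma (in prob_space) gaussian_variable_square_integrable:
  assumes "gaussian_variable M X"
  shows "integrable M (\<lambda>\<omega>. (X \<omega>)\<^sup>2)"
proof -
  have [measurable]: "X \<in> borel_measurable M" using assms by (simp add: gaussian_variable_def)
  consider m where "AE \<omega> in M. X \<omega> = m"
    | m \<sigma> where "0 < \<sigma>" "distributed M lborel X (\<lambda>x. ennreal (normal_density m \<sigma> x))"
    using assms unfolding gaussian_variable_def by blast
  then show ?thesis
  proof cases
    case 1
    have "integrable M (\<lambda>\<omega>. m\<^sup>2)" by simp
    moreover have "AE \<omega> in M. m\<^sup>2 = (X \<omega>)\<^sup>2" using 1 by eventually_elim simp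
    ultimately show ?thesis by (subst (asm) integrable_cong_AE) auto
  next
    case 2
    have "integrable lborel (\<lambda>x. normal_density m \<sigma> x * (x - m) ^ 2 + 2 * m * (normal_density m \<sigma> x * x) - m\<^sup>2 * normal_density m \<sigma> x)"
      by (intro Bochner_Integration.integrable_diff Bochner_Integration.integrable_add integrable_mult_right
          integrable_normal_moment[OF 2(1)] integrable_normal_moment_nz_1[OF 2(1)] integrable_normal_density[OF 2(1)])
    also have "(\<lambda>x. normal_density m \<sigma> x * (x - m) ^ 2 + 2 * m * (normal_density m \<sigma> x * x) - m\<^sup>2 * normal_density m \<sigma> x)
       = (\<lambda>x. normal_density m \<sigma> x * x\<^sup>2)"
      by (simp add: fun_eq_iff power2_eq_square algebra_simps)
    finally show ?thesis
      using distributed_integrable[OF 2(2), of "\<lambda>x. x\<^sup>2"] by simp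
  qed
qed

text \<open>Mean zero forces a degenerate variable to vanish almost surely, so the formula for
  positive variance extends to variance zero.\<close>

lemma (in prob_space) gaussian_variable_char:
  assumes X: "gaussian_variable M X" and mean: "expectation X = 0"
  shows "(CLINT \<omega>|M. iexp (X \<omega>)) = exp (- ((LINT \<omega>|M. (X \<omega>)\<^sup>2) / 2))"
proof -
  have [measurable]: "X \<in> borel_measurable M" using X by (simp add: gaussian_variable_def)
  consider m where "AE \<omega> in M. X \<omega> = m"
    | m \<sigma> where "0 < \<sigma>" "distributed M lborel X (\<lambda>x. ennreal (normal_density m \<sigma> x))"
    using X unfolding gaussian_variable_def by blast
  then show ?thesis
  proof cases
    case 1
    then have "expectation X = (LINT \<omega>|M. m)" by (intro integral_cong_AE) auto
    then have X0: "AE \<omega> in M. X \<omega> = 0" using 1 mean by (simp add: prob_space)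
    have "(CLINT \<omega>|M. iexp (X \<omega>)) = (CLINT \<omega>|M. 1)"
      using X0 by (intro integral_cong_AE) auto
    moreover have "(LINT \<omega>|M. (X \<omega>)\<^sup>2) = (LINT \<omega>|M. 0)"
      using X0 by (intro integral_cong_AE) auto
    ultimately show ?thesis by (simp add: prob_space)
  next
    case 2
    have "m = 0" using normal_distributed_expectation[OF 2] mean by simp
    then have var: "(LINT \<omega>|M. (X \<omega>)\<^sup>2) = \<sigma>\<^sup>2"
      using normal_distributed_variance[OF 2] mean by simp
    have "distributed M lborel (\<lambda>\<omega>. X \<omega> / \<sigma>) std_normal_density"
      using 2(2) normal_standard_normal_convert[OF 2(1), of X m] \<open>m = 0\<close> by simp
    then have "distr M lborel (\<lambda>\<omega>. X \<omega> / \<sigma>) = std_normal_distribution"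
      by (rule distributed_distr_eq_density)
    then have "(CLINT x|distr M lborel (\<lambda>\<omega>. X \<omega> / \<sigma>). iexp (\<sigma> * x)) = exp (- \<sigma>\<^sup>2 / 2)"
      using fun_cong[OF char_std_normal_distribution, of \<sigma>] by (simp add: char_def exp_of_real)
    also have "(CLINT x|distr M lborel (\<lambda>\<omega>. X \<omega> / \<sigma>). iexp (\<sigma> * x)) = (CLINT \<omega>|M. iexp (X \<omega>))"
      using 2(1) by (subst integral_distr) auto
    finally show ?thesis by (simp add: var)
  qed
qed

section \<open>Bounds on the covariance of fractional Brownian motion\<close>

text \<open>After division by \<open>x + y\<close> the two summands are fractions \<open>u\<close>
  in \<open>[0,1]\<close> with sum 1, and \<open>u powr p \<le> u\<close> there.\<close>

lemma powr_superadditive: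
  fixes x y p :: real
  assumes "0 \<le> x" "0 \<le> y" "1 \<le> p"
  shows "x powr p + y powr p \<le> (x + y) powr p"
proof (cases "x + y = 0")
  case False
  then have s: "0 < x + y" using assms by linarith
  have le: "u powr p \<le> u" if "0 \<le> u" "u \<le> 1" for u :: real
    using powr_mono'[OF \<open>1 \<le> p\<close> that] that by simp
  have "x powr p + y powr p = (x + y) powr p * ((x / (x + y)) powr p + (y / (x + y)) powr p)"
    using s assms by (simp add: powr_divide distrib_left)
  also have "\<dots> \<le> (x + y) powr p * (x / (x + y) + y / (x + y))"
    using s assms by (intro mult_left_mono add_mono le) (auto simp: field_simps)
  also have "x / (x + y) + y / (x + y) = 1" using s by (simp add: add_divide_distrib[symmetric])
  finally show ?thesis by simp
next
  case True
  then have "x = 0" "y = 0" using assms by linarith+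
  then show ?thesis by simp
qed

text \<open>For \<open>s \<le> t\<close>, superadditivity along \<open>t = s + (t - s)\<close> shows
  that the covariance is at least \<open>s powr p\<close>. This is where \<open>H > 1/2\<close>
  enters, with \<open>p = 2 * H\<close>. The upper bound follows by dropping the subtracted
  term.\<close>

lemma fbm_covariance_bounds:
  fixes s t a b p :: real
  assumes p: "1 \<le> p" and a: "0 < a" and s: "s \<in> {a..b}" and t: "t \<in> {a..b}"
  shows "a powr p \<le> (t powr p + s powr p - \<bar>t - s\<bar> powr p) / 2"
    and "(t powr p + s powr p - \<bar>t - s\<bar> powr p) / 2 \<le> b powr p"
proof -
  have "a powr p \<le> (t powr p + s powr p - \<bar>t - s\<bar> powr p) / 2" if "s \<le> t" "s \<in> {a..b}" for s t
  proof -
    have "s powr p + (t - s) powr p \<le> t powr p"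
      using powr_superadditive[of s "t - s" p] that a p by simp
    moreover have "a powr p \<le> s powr p" using that a p by (intro powr_mono2) auto
    moreover have "\<bar>t - s\<bar> = t - s" using that by simp
    ultimately show ?thesis by simp
  qed
  from this[of s t] this[of t s] show "a powr p \<le> (t powr p + s powr p - \<bar>t - s\<bar> powr p) / 2"
    using s t by (cases "s \<le> t") (auto simp: abs_minus_commute add.commute)
  have mean_le: "(u + v - w) / 2 \<le> r" if "u \<le> r" "v \<le> r" "0 \<le> w" for u v w r :: real
    using that by argo
  show "(t powr p + s powr p - \<bar>t - s\<bar> powr p) / 2 \<le> b powr p"
    by (rule mean_le) (use s t a p in \<open>auto intro!: powr_mono2\<close>)
qed

text \<open>
  If an expectation exceeded a level that \<open>Y\<close> stays below with probability more than \<open>1/2\<close> by two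
  standard deviations, this would contradict Chebyshev's inequality.
\<close>

lemma (in prob_space) bounded_by_rv_and_variance:
  fixes Y :: "'a \<Rightarrow> real" and S :: "nat \<Rightarrow> 'a \<Rightarrow> real"
  assumes Y[measurable]: "Y \<in> borel_measurable M"
    and S[measurable]: "\<And>n. S n \<in> borel_measurable M" and sq: "\<And>n. integrable M (\<lambda>\<omega>. (S n \<omega>)\<^sup>2)"
    and le: "\<And>n \<omega>. \<omega> \<in> space M \<Longrightarrow> S n \<omega> \<le> Y \<omega>"
    and var: "\<And>n. variance (S n) \<le> v" and v: "0 < v"
  shows "\<exists>C. \<forall>n. expectation (S n) \<le> C"
proof -
  interpret D: real_distribution "distr M borel Y" by (rule real_distribution_distr) measurable
  have "eventually (\<lambda>x. 1 / 2 < cdf (distr M borel Y) x) at_top"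
    using D.cdf_lim_at_top_prob by (rule order_tendstoD) simp
  then obtain k where "1 / 2 < cdf (distr M borel Y) k"
    by (auto simp: eventually_at_top_linorder)
  then have k: "1 / 2 < prob {\<omega>\<in>space M. Y \<omega> \<le> k}"
    by (simp add: cdf_def measure_distr vimage_def Int_def conj_commute)
  have "expectation (S n) \<le> k + 2 * sqrt v" for n
  proof (rule ccontr)
    assume n: "\<not> expectation (S n) \<le> k + 2 * sqrt v"
    have "prob {\<omega>\<in>space M. Y \<omega> \<le> k} \<le> prob {\<omega>\<in>space M. 2 * sqrt v \<le> \<bar>S n \<omega> - expectation (S n)\<bar>}"
    proof (rule finite_measure_mono)
      show "{\<omega>\<in>space M. Y \<omega> \<le> k} \<subseteq> {\<omega>\<in>space M. 2 * sqrt v \<le> \<bar>S n \<omega> - expectation (S n)\<bar>}"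
      proof safe
        fix \<omega> assume "\<omega> \<in> space M" "Y \<omega> \<le> k"
        then show "2 * sqrt v \<le> \<bar>S n \<omega> - expectation (S n)\<bar>" using le[of \<omega> n] n by linarith
      qed
    qed measurable
    also have "\<dots> \<le> variance (S n) / (2 * sqrt v)\<^sup>2"
      using v by (intro Chebyshev_inequality sq) auto
    also have "\<dots> \<le> v / (2 * sqrt v)\<^sup>2" using var by (intro divide_right_mono) auto
    also have "\<dots> = 1 / 4" using v by (simp add: power_mult_distrib)
    finally show False using k by linarith
  qed
  then show ?thesis by blast
qed

locale fbm_interval = prob_space M for M :: "'a measure" +
  fixes B :: "real \<Rightarrow> 'a \<Rightarrow> real" and H a b :: real
  assumes a: "0 < a" and ab: "a < b" and H: "1 / 2 < H"
    and fbm: "fractional_brownian_motion M H B"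
begin

text \<open>
  Nothing is known about \<open>B t\<close> for \<open>t < 0\<close>, not even measurability, hence the truncation in \<open>X\<close>. The inverse
  temperature \<open>temp n\<close> makes the error \<open>ln (card (grid n)) / temp n\<close> of the softmax vanish.
\<close>

definition X where "X t = B (max 0 t)"
definition Y where "Y \<omega> = (SUP t\<in>{a..b}. B t \<omega>)"
definition grid where "grid n = (\<lambda>k. a + (b - a) * real k / real (Suc n)) ` {..Suc n}" for n :: nat
definition temp where "temp n = (real (Suc (Suc n)))\<^sup>2" for n :: nat
definition S where "S n \<omega> = softmax (temp n) (grid n) (\<lambda>t. X t \<omega>)"
definition S0 where "S0 n \<omega> = S n \<omega> - expectation (S n)"
definition Z where "Z \<omega> = Y \<omega> - expectation Y"

lemma gaussian_lin: "finite F \<Longrightarrow> F \<subseteq> {0..} \<Longrightarrow> gaussian_variable M (\<lambda>\<omega>. \<Sum>t\<in>F. c t * B t \<omega>)"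
  using fbm unfolding fractional_brownian_motion_def centered_gaussian_process_def gaussian_process_def by blast

lemma gaussian_B: "0 \<le> t \<Longrightarrow> gaussian_variable M (B t)"
  using gaussian_lin[of "{t}" "\<lambda>_. 1"] by simp

lemma mean_B: "0 \<le> t \<Longrightarrow> expectation (B t) = 0"
  using fbm unfolding fractional_brownian_motion_def centered_gaussian_process_def by simp

lemma measurable_X[measurable]: "X t \<in> borel_measurable M"
  using gaussian_B[of "max 0 t"] by (simp add: X_def gaussian_variable_def)

lemma X_sq: "integrable M (\<lambda>\<omega>. (X t \<omega>)\<^sup>2)"
  unfolding X_def by (rule gaussian_variable_square_integrable) (simp add: gaussian_B)

lemma integrable_X: "integrable M (X t)"
  by (rule square_integrable_imp_integrable[OF _ X_sq]) measurable

lemma cov_X: "s \<in> {a..b} \<Longrightarrow> t \<in> {a..b} \<Longrightarrow>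
  expectation (\<lambda>\<omega>. X t \<omega> * X s \<omega>) = (t powr (2 * H) + s powr (2 * H) - \<bar>t - s\<bar> powr (2 * H)) / 2"
  using fbm a unfolding fractional_brownian_motion_def by (simp add: X_def max_def)

lemma gaussian_vector_X:
  assumes "finite I" "I \<noteq> {}" "I \<subseteq> {0..}"
  shows "gaussian_vector M I X"
proof unfold_locales
  fix c :: "real \<Rightarrow> real"
  have X: "(\<Sum>i\<in>I. c i * X i \<omega>) = (\<Sum>i\<in>I. c i * B i \<omega>)" for \<omega>
    using assms(3) by (intro sum.cong) (auto simp: X_def max_def)
  have "expectation (\<lambda>\<omega>. \<Sum>i\<in>I. c i * B i \<omega>) = (\<Sum>i\<in>I. c i * expectation (B i))"
  proof (subst Bochner_Integration.integral_sum)
    show "integrable M (\<lambda>\<omega>. c i * B i \<omega>)" if "i \<in> I" for i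
      using integrable_X[of i] that assms(3) by (auto simp: X_def max_def)
  qed simp
  also have "\<dots> = 0" using assms(3) mean_B by (intro sum.neutral) auto
  finally show "(CLINT \<omega>|M. iexp (\<Sum>i\<in>I. c i * X i \<omega>)) = exp (- ((LINT \<omega>|M. (\<Sum>i\<in>I. c i * X i \<omega>)\<^sup>2) / 2))"
    unfolding X using gaussian_lin[OF assms(1,3)] by (intro gaussian_variable_char) auto
qed (use assms X_sq in auto)

section \<open>Smooth maxima over finer and finer grids\<close>

lemma grid: "finite (grid n)" "grid n \<noteq> {}" "a \<in> grid n" "grid n \<subseteq> {a..b}" "card (grid n) \<le> Suc (Suc n)"
proof -
  show "finite (grid n)" "grid n \<noteq> {}" unfolding grid_def by auto
  show "a \<in> grid n" unfolding grid_def by (auto intro!: image_eqI[of _ _ 0])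
  show "grid n \<subseteq> {a..b}"
  proof
    fix t assume "t \<in> grid n"
    then obtain k where k: "k \<le> Suc n" "t = a + (b - a) * (real k / real (Suc n))"
      unfolding grid_def by auto
    define q where "q = real k / real (Suc n)"
    have q: "0 \<le> q" "q \<le> 1" using k by (auto simp: q_def divide_le_eq)
    have "0 \<le> (b - a) * q" "(b - a) * q \<le> b - a"
      using q ab mult_left_le[of q "b - a"] by (auto intro!: mult_nonneg_nonneg)
    then show "t \<in> {a..b}" unfolding k(2) q_def[symmetric] by auto
  qed
  show "card (grid n) \<le> Suc (Suc n)" unfolding grid_def using card_image_le[of "{..Suc n}"] by force
qed

lemma temp: "0 < temp n" by (simp add: temp_def)

text \<open>\<open>temp n\<close> is the square of \<open>n + 2\<close>, an upper bound for the
  number of grid points, so the crude estimate \<open>ln m \<le> m\<close> already makes the error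
  vanish.\<close>

lemma log_card_le: "ln (real (card (grid n))) / temp n \<le> 1 / real (Suc n)"
proof -
  have c: "0 < card (grid n)" using grid[of n] by (simp add: card_gt_0_iff)
  then have "ln (real (card (grid n))) \<le> real (card (grid n))"
    using ln_le_minus_one[of "real (card (grid n))"] by simp
  also have "\<dots> \<le> real (Suc (Suc n))" using grid(5)[of n] by linarith
  finally have "ln (real (card (grid n))) / temp n \<le> real (Suc (Suc n)) / temp n"
    using temp by (intro divide_right_mono) (auto simp: less_imp_le)
  also have "\<dots> = 1 / real (Suc (Suc n))" by (simp add: temp_def power2_eq_square)
  also have "\<dots> \<le> 1 / real (Suc n)" by (intro divide_left_mono) auto
  finally show ?thesis .
qed

lemma X_eq_B: "t \<in> {a..b} \<Longrightarrow> X t = B t"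
  using a by (simp add: X_def max_def)

lemma continuous_B:
  assumes "\<omega> \<in> space M"
  shows "continuous_on {a..b} (\<lambda>t. B t \<omega>)"
  by (rule continuous_on_subset[of "{0..}"])
     (use fbm assms a in \<open>auto simp: fractional_brownian_motion_def\<close>)

lemma sup_attained:
  assumes "\<omega> \<in> space M"
  obtains t where "t \<in> {a..b}" "Y \<omega> = B t \<omega>" "\<And>s. s \<in> {a..b} \<Longrightarrow> B s \<omega> \<le> B t \<omega>"
proof -
  obtain t where t: "t \<in> {a..b}" "\<And>s. s \<in> {a..b} \<Longrightarrow> B s \<omega> \<le> B t \<omega>"
    using continuous_attains_sup[of "{a..b}" "\<lambda>t. B t \<omega>"] continuous_B[OF assms] ab by auto
  then have "Y \<omega> = B t \<omega>" unfolding Y_def by (intro cSup_eq_maximum) auto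
  with t show ?thesis using that by blast
qed

lemma S_ge: "t \<in> grid n \<Longrightarrow> B t \<omega> \<le> S n \<omega>"
  using softmax_ge[OF grid(1) _ temp, of t n "\<lambda>t. X t \<omega>" n] X_eq_B[of t] grid(4)[of n] unfolding S_def by auto

lemma S_le:
  assumes "\<omega> \<in> space M"
  shows "S n \<omega> \<le> Y \<omega> + 1 / real (Suc n)"
proof -
  obtain t where t: "t \<in> {a..b}" "Y \<omega> = B t \<omega>" "\<And>s. s \<in> {a..b} \<Longrightarrow> B s \<omega> \<le> B t \<omega>"
    by (rule sup_attained[OF assms], rule that)
  have "S n \<omega> \<le> Y \<omega> + ln (real (card (grid n))) / temp n"
    unfolding S_def
  proof (rule softmax_le[OF grid(1,2) temp])
    show "X i \<omega> \<le> Y \<omega>" if "i \<in> grid n" for i using t grid(4)[of n] that X_eq_B[of i] by auto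
  qed
  then show ?thesis using log_card_le[of n] by linarith
qed

lemma S_le1: "\<omega> \<in> space M \<Longrightarrow> S n \<omega> \<le> Y \<omega> + 1"
  using S_le[of \<omega> n] by (rule order_trans) auto

lemma grid_dense:
  assumes t: "t \<in> {a..b}"
  shows "\<exists>s\<in>grid n. \<bar>s - t\<bar> \<le> (b - a) / real (Suc n)"
proof -
  define r where "r = (t - a) / (b - a) * real (Suc n)"
  define k where "k = nat \<lfloor>r\<rfloor>"
  have r: "0 \<le> r" "r \<le> real (Suc n)"
  proof -
    have q: "0 \<le> (t - a) / (b - a)" "(t - a) / (b - a) \<le> 1" using t ab by (auto simp: divide_le_eq)
    show "0 \<le> r" unfolding r_def using q by (intro mult_nonneg_nonneg) auto
    show "r \<le> real (Suc n)" unfolding r_def using q by (intro mult_left_le_one_le) auto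
  qed
  then have k: "real k \<le> r" "r < real k + 1" "k \<le> Suc n" unfolding k_def by linarith+
  define s where "s = a + (b - a) * real k / real (Suc n)"
  have "s \<in> grid n" unfolding s_def grid_def using k by auto
  have d: "0 < (b - a) / real (Suc n)" using ab by simp
  have "t = a + (b - a) / real (Suc n) * r" unfolding r_def using ab by (simp del: of_nat_Suc)
  then have "t - s = (b - a) / real (Suc n) * (r - real k)" unfolding s_def by (simp add: right_diff_distrib)
  moreover have "0 \<le> (b - a) / real (Suc n) * (r - real k)"
    by (rule mult_nonneg_nonneg) (use d k in linarith)+
  moreover have "(b - a) / real (Suc n) * (r - real k) \<le> (b - a) / real (Suc n)"
    by (rule mult_left_le) (use d k in linarith)+
  ultimately have "\<bar>s - t\<bar> \<le> (b - a) / real (Suc n)" by linarith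
  with \<open>s \<in> grid n\<close> show ?thesis by blast
qed

text \<open>Squeezes \<open>S n\<close> between the path at grid points converging to a maximizer,
  where continuity applies, and the supremum plus the softmax error.\<close>

lemma S_tendsto:
  assumes "\<omega> \<in> space M"
  shows "(\<lambda>n. S n \<omega>) \<longlonglongrightarrow> Y \<omega>"
proof -
  obtain t where t: "t \<in> {a..b}" "Y \<omega> = B t \<omega>" "\<And>s. s \<in> {a..b} \<Longrightarrow> B s \<omega> \<le> B t \<omega>"
    by (rule sup_attained[OF assms], rule that)
  obtain s where s: "\<And>n. s n \<in> grid n" "\<And>n. \<bar>s n - t\<bar> \<le> (b - a) / real (Suc n)"
    using grid_dense[OF t(1)] by metis
  have null: "(\<lambda>n. c / real (Suc n)) \<longlonglongrightarrow> 0" for c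
    using LIMSEQ_ignore_initial_segment[OF lim_const_over_n[of c], of 1] by simp
  have "(\<lambda>n. s n - t) \<longlonglongrightarrow> 0"
    by (rule Lim_null_comparison[OF _ null[of "b - a"]]) (use s(2) in auto)
  then have "s \<longlonglongrightarrow> t" by (simp add: LIM_zero_iff)
  moreover have "s n \<in> {a..b}" for n using s(1)[of n] grid(4)[of n] by blast
  ultimately have "(\<lambda>n. B (s n) \<omega>) \<longlonglongrightarrow> B t \<omega>"
    using continuous_B[OF assms] t(1) unfolding continuous_on_sequentially comp_def by blast
  moreover have "(\<lambda>n. Y \<omega> + 1 / real (Suc n)) \<longlonglongrightarrow> Y \<omega> + 0"
    by (intro tendsto_intros null)
  ultimately show ?thesis
    using S_ge[OF s(1)] S_le[OF assms] t(2)
    by (intro tendsto_sandwich[of "\<lambda>n. B (s n) \<omega>" "\<lambda>n. S n \<omega>" sequentially "\<lambda>n. Y \<omega> + 1 / real (Suc n)"]) auto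
qed

lemma measurable_S[measurable]: "S n \<in> borel_measurable M"
  unfolding S_def[abs_def] by measurable

lemma measurable_Y[measurable]: "Y \<in> borel_measurable M"
  by (rule borel_measurable_LIMSEQ_real[OF S_tendsto]) auto

lemma p: "1 \<le> 2 * H" using H by simp

lemma S_stein:
  assumes \<phi>: "\<And>x. (\<phi> has_real_derivative \<psi> x) (at x)"
    and \<psi>c: "continuous_on UNIV \<psi>" and \<psi>: "\<And>x. 0 \<le> \<psi> x" "\<And>x. \<psi> x \<le> 1"
  shows "integrable M (\<lambda>\<omega>. (S n \<omega>)\<^sup>2)"
    and "a powr (2 * H) * expectation (\<lambda>\<omega>. \<psi> (S n \<omega>)) \<le>
      expectation (\<lambda>\<omega>. S n \<omega> * \<phi> (S n \<omega>)) - expectation (S n) * expectation (\<lambda>\<omega>. \<phi> (S n \<omega>))"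
    and "expectation (\<lambda>\<omega>. S n \<omega> * \<phi> (S n \<omega>)) - expectation (S n) * expectation (\<lambda>\<omega>. \<phi> (S n \<omega>))
      \<le> b powr (2 * H) * expectation (\<lambda>\<omega>. \<psi> (S n \<omega>))"
proof -
  have sub: "grid n \<subseteq> {0..}" using grid(4)[of n] a by auto
  interpret V: gaussian_vector M "grid n" X
    by (rule gaussian_vector_X[OF grid(1,2) sub])
  show "integrable M (\<lambda>\<omega>. (S n \<omega>)\<^sup>2)" unfolding S_def by (rule V.smax_sq[OF temp])
  have K: "a powr (2 * H) \<le> V.K i j \<and> V.K i j \<le> b powr (2 * H)" if "i \<in> grid n" "j \<in> grid n" for i j
  proof -
    have "i \<in> {a..b}" "j \<in> {a..b}" using that grid(4)[of n] by auto
    then show ?thesis using fbm_covariance_bounds[OF p a, of j b i] cov_X[of j i] unfolding V.K_def by simp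
  qed
  have "0 < a powr (2 * H)" using a by simp
  from V.covariance_bounds[OF temp \<phi> \<psi>c \<psi> this K, of n]
  show "a powr (2 * H) * expectation (\<lambda>\<omega>. \<psi> (S n \<omega>)) \<le>
      expectation (\<lambda>\<omega>. S n \<omega> * \<phi> (S n \<omega>)) - expectation (S n) * expectation (\<lambda>\<omega>. \<phi> (S n \<omega>))"
    "expectation (\<lambda>\<omega>. S n \<omega> * \<phi> (S n \<omega>)) - expectation (S n) * expectation (\<lambda>\<omega>. \<phi> (S n \<omega>))
      \<le> b powr (2 * H) * expectation (\<lambda>\<omega>. \<psi> (S n \<omega>))"
    unfolding S_def by auto
qed

lemma S_sq: "integrable M (\<lambda>\<omega>. (S n \<omega>)\<^sup>2)"
  by (rule S_stein(1)[of "\<lambda>x. x" "\<lambda>_. 1"]) auto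

lemma integrable_S: "integrable M (S n)"
  by (rule square_integrable_imp_integrable[OF _ S_sq]) measurable

lemma variance_S: "variance (S n) \<le> b powr (2 * H)"
proof -
  have "variance (S n) = expectation (\<lambda>\<omega>. (S n \<omega>)\<^sup>2) - (expectation (S n))\<^sup>2"
    by (rule variance_eq[OF integrable_S S_sq])
  also have "\<dots> \<le> b powr (2 * H) * expectation (\<lambda>\<omega>. 1)"
    using S_stein(3)[of "\<lambda>x. x" "\<lambda>_. 1" n] by (simp add: power2_eq_square)
  finally show ?thesis by (simp add: prob_space)
qed

section \<open>Integrability of the supremum and passage to the limit\<close>

text \<open>Fatou needs nonnegative functions. As \<open>a\<close> lies in every grid,
  \<open>S n - X a\<close> is nonnegative, and since \<open>X a\<close> has mean zero, its
  expectation is that of \<open>S n\<close>, which is bounded uniformly in \<open>n\<close>.\<close>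

lemma integrable_Y: "integrable M Y"
proof -
  have "\<exists>C. \<forall>n. expectation (S n) \<le> C"
    using a ab by (intro bounded_by_rv_and_variance[where Y = "\<lambda>\<omega>. Y \<omega> + 1" and v = "b powr (2 * H)"] S_sq S_le1 variance_S) auto
  then obtain C where C: "\<And>n. expectation (S n) \<le> C" by blast
  have "integrable M (\<lambda>\<omega>. Y \<omega> - X a \<omega>)"
  proof (rule integrable_fatou[where f = "\<lambda>n \<omega>. S n \<omega> - X a \<omega>"])
    show "integrable M (\<lambda>\<omega>. S n \<omega> - X a \<omega>)" for n
      by (intro Bochner_Integration.integrable_diff integrable_S integrable_X)
    show "0 \<le> S n \<omega> - X a \<omega>" for n \<omega>
      using S_ge[OF grid(3), of \<omega> n] X_eq_B[of a] ab by simp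
    show "expectation (\<lambda>\<omega>. S n \<omega> - X a \<omega>) \<le> C" for n
      using C[of n] integrable_S[of n] integrable_X[of a] mean_B[of a] X_eq_B[of a] ab a by simp
    show "(\<lambda>n. S n \<omega> - X a \<omega>) \<longlonglongrightarrow> Y \<omega> - X a \<omega>" if "\<omega> \<in> space M" for \<omega>
      by (intro tendsto_intros S_tendsto that)
  qed
  from Bochner_Integration.integrable_add[OF this integrable_X[of a]] show ?thesis by simp
qed

text \<open>A common bound for all \<open>S n\<close>: the value at \<open>a\<close> bounds them
  from below and \<open>Y + 1\<close> from above.\<close>

definition W where "W \<omega> = \<bar>X a \<omega>\<bar> + \<bar>Y \<omega>\<bar> + 1"

lemma abs_S_le: "\<omega> \<in> space M \<Longrightarrow> \<bar>S n \<omega>\<bar> \<le> W \<omega>"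
  using S_ge[OF grid(3), of \<omega> n] X_eq_B[of a] ab S_le1[of \<omega> n] unfolding W_def by auto

lemma integrable_W: "integrable M W"
  unfolding W_def[abs_def] using integrable_X integrable_Y by auto

lemma expectation_S_tendsto: "(\<lambda>n. expectation (S n)) \<longlonglongrightarrow> expectation Y"
  by (rule integral_dominated_convergence[OF _ _ integrable_W])
     (use S_tendsto abs_S_le in auto)

lemma S0_tendsto: "\<omega> \<in> space M \<Longrightarrow> (\<lambda>n. S0 n \<omega>) \<longlonglongrightarrow> Z \<omega>"
  unfolding S0_def Z_def by (intro tendsto_intros S_tendsto expectation_S_tendsto)

lemma measurable_S0_Z[measurable]: "S0 n \<in> borel_measurable M" "Z \<in> borel_measurable M"
  unfolding S0_def[abs_def] Z_def[abs_def] by measurable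

lemma S0_sq: "integrable M (\<lambda>\<omega>. (S0 n \<omega>)\<^sup>2)"
  using integrable_add_square[of "S n" M "\<lambda>_. - expectation (S n)"] S_sq by (simp add: S0_def)

text \<open>The variance bound is uniform in \<open>n\<close>, so Fatou carries it to the limit.
  Square integrability of \<open>Y\<close> and then of \<open>W\<close> follows, which dominates the
  products \<open>S0 n \<omega> * \<phi> (S0 n \<omega>)\<close> in \<open>Z_stein\<close>.\<close>

lemma Z_sq: "integrable M (\<lambda>\<omega>. (Z \<omega>)\<^sup>2)"
proof (rule integrable_fatou[where f = "\<lambda>n \<omega>. (S0 n \<omega>)\<^sup>2"])
  show "expectation (\<lambda>\<omega>. (S0 n \<omega>)\<^sup>2) \<le> b powr (2 * H)" for n
    unfolding S0_def by (rule variance_S)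
  show "(\<lambda>n. (S0 n \<omega>)\<^sup>2) \<longlonglongrightarrow> (Z \<omega>)\<^sup>2" if "\<omega> \<in> space M" for \<omega>
    by (intro tendsto_intros S0_tendsto that)
qed (auto simp: S0_sq)

lemma Y_sq: "integrable M (\<lambda>\<omega>. (Y \<omega>)\<^sup>2)"
  using integrable_add_square[of Z M "\<lambda>_. expectation Y"] Z_sq by (simp add: Z_def)

lemma W_sq: "integrable M (\<lambda>\<omega>. (W \<omega> + expectation W)\<^sup>2)"
  unfolding W_def using X_sq[of a] Y_sq by (intro integrable_add_square) auto

lemma abs_S0_le:
  assumes "\<omega> \<in> space M"
  shows "\<bar>S0 n \<omega>\<bar> \<le> W \<omega> + expectation W"
proof -
  have "\<bar>expectation (S n)\<bar> \<le> expectation (\<lambda>\<omega>. \<bar>S n \<omega>\<bar>)" by (rule integral_abs_bound)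
  also have "\<dots> \<le> expectation W"
    using integrable_S integrable_W abs_S_le by (intro integral_mono) auto
  finally show ?thesis using abs_S_le[OF assms, of n] unfolding S0_def by linarith
qed

lemma Z_stein:
  assumes \<phi>: "\<And>x. (\<phi> has_real_derivative \<psi> x) (at x)" and \<phi>0: "\<phi> 0 = 0"
    and \<psi>c: "continuous_on UNIV \<psi>" and \<psi>: "\<And>x. 0 \<le> \<psi> x" "\<And>x. \<psi> x \<le> 1"
  shows "a powr (2 * H) * expectation (\<lambda>\<omega>. \<psi> (Z \<omega>)) \<le> expectation (\<lambda>\<omega>. Z \<omega> * \<phi> (Z \<omega>))"
    and "expectation (\<lambda>\<omega>. Z \<omega> * \<phi> (Z \<omega>)) \<le> b powr (2 * H) * expectation (\<lambda>\<omega>. \<psi> (Z \<omega>))"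
proof -
  have [measurable]: "\<psi> \<in> borel_measurable borel"
    by (rule borel_measurable_continuous_onI[OF \<psi>c])
  have \<phi>c: "continuous_on UNIV \<phi>"
    using \<phi> by (intro continuous_at_imp_continuous_on ballI DERIV_isCont) auto
  then have [measurable]: "\<phi> \<in> borel_measurable borel"
    by (rule borel_measurable_continuous_onI)
  have lip: "\<bar>\<phi> x\<bar> \<le> \<bar>x\<bar>" for x
    using field_differentiable_bound[of UNIV \<phi> \<psi> 1 x 0] \<phi> \<phi>0 \<psi> by simp
  have x\<phi>: "\<bar>x * \<phi> x\<bar> \<le> x\<^sup>2" for x
    using mult_left_mono[OF lip[of x], of "\<bar>x\<bar>"] by (simp add: abs_mult power2_eq_square)
  have lim\<psi>: "(\<lambda>n. expectation (\<lambda>\<omega>. \<psi> (S0 n \<omega>))) \<longlonglongrightarrow> expectation (\<lambda>\<omega>. \<psi> (Z \<omega>))"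
  proof (rule integral_dominated_convergence[where w = "\<lambda>_. 1"])
    show "AE \<omega> in M. (\<lambda>n. \<psi> (S0 n \<omega>)) \<longlonglongrightarrow> \<psi> (Z \<omega>)"
      using \<psi>c by (intro AE_I2 continuous_on_tendsto_compose[OF \<psi>c S0_tendsto]) auto
  qed (use \<psi> in auto)
  have lim\<phi>: "(\<lambda>n. expectation (\<lambda>\<omega>. S0 n \<omega> * \<phi> (S0 n \<omega>))) \<longlonglongrightarrow> expectation (\<lambda>\<omega>. Z \<omega> * \<phi> (Z \<omega>))"
  proof (rule integral_dominated_convergence[OF _ _ W_sq])
    show "AE \<omega> in M. (\<lambda>n. S0 n \<omega> * \<phi> (S0 n \<omega>)) \<longlonglongrightarrow> Z \<omega> * \<phi> (Z \<omega>)"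
      by (intro AE_I2 tendsto_mult S0_tendsto continuous_on_tendsto_compose[OF \<phi>c S0_tendsto]) auto
    show "AE \<omega> in M. norm (S0 n \<omega> * \<phi> (S0 n \<omega>)) \<le> (W \<omega> + expectation W)\<^sup>2" for n
    proof (rule AE_I2)
      fix \<omega> assume "\<omega> \<in> space M"
      from power_mono[OF abs_S0_le[OF this, of n], of 2] x\<phi>[of "S0 n \<omega>"]
      show "norm (S0 n \<omega> * \<phi> (S0 n \<omega>)) \<le> (W \<omega> + expectation W)\<^sup>2" by simp
    qed
  qed measurable
  have n: "a powr (2 * H) * expectation (\<lambda>\<omega>. \<psi> (S0 n \<omega>)) \<le> expectation (\<lambda>\<omega>. S0 n \<omega> * \<phi> (S0 n \<omega>))
    \<and> expectation (\<lambda>\<omega>. S0 n \<omega> * \<phi> (S0 n \<omega>)) \<le> b powr (2 * H) * expectation (\<lambda>\<omega>. \<psi> (S0 n \<omega>))" for n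
  proof -
    \<comment> \<open>Shifting \<open>\<phi>\<close> by the mean of \<open>S n\<close> turns the
      covariance in \<open>S_stein\<close> into the expectation of
      \<open>S0 n \<omega> * \<phi> (S0 n \<omega>)\<close>.\<close>
    let ?m = "expectation (S n)"
    have \<phi>m: "((\<lambda>x. \<phi> (x - ?m)) has_real_derivative \<psi> (x - ?m)) (at x)" for x
    proof -
      have "((\<lambda>x. x - ?m) has_real_derivative 1) (at x)" by (auto intro!: derivative_eq_intros)
      from DERIV_chain2[OF \<phi> this] show ?thesis by simp
    qed
    have \<psi>m: "continuous_on UNIV (\<lambda>x. \<psi> (x - ?m))"
      by (intro continuous_on_compose2[OF \<psi>c] continuous_intros) auto
    have \<phi>S0_sq: "integrable M (\<lambda>\<omega>. (\<phi> (S0 n \<omega>))\<^sup>2)"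
      by (rule integrable_square_bound[where g = "\<lambda>\<omega>. \<bar>S0 n \<omega>\<bar>"]) (use S0_sq lip in auto)
    have "integrable M (\<lambda>\<omega>. \<phi> (S0 n \<omega>))"
      by (rule square_integrable_imp_integrable[OF _ \<phi>S0_sq]) measurable
    moreover have "integrable M (\<lambda>\<omega>. S n \<omega> * \<phi> (S0 n \<omega>))"
      by (intro integrable_mult_of_squares S_sq \<phi>S0_sq) measurable
    ultimately have "expectation (\<lambda>\<omega>. S0 n \<omega> * \<phi> (S0 n \<omega>)) = expectation (\<lambda>\<omega>. S n \<omega> * \<phi> (S0 n \<omega>)) - ?m * expectation (\<lambda>\<omega>. \<phi> (S0 n \<omega>))"
      by (simp add: S0_def left_diff_distrib)
    then show ?thesis
      using S_stein(2,3)[OF \<phi>m \<psi>m \<psi>, of n] unfolding S0_def by simp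
  qed
  show "a powr (2 * H) * expectation (\<lambda>\<omega>. \<psi> (Z \<omega>)) \<le> expectation (\<lambda>\<omega>. Z \<omega> * \<phi> (Z \<omega>))"
    using n by (intro LIMSEQ_le[OF tendsto_mult_left[OF lim\<psi>] lim\<phi>]) auto
  show "expectation (\<lambda>\<omega>. Z \<omega> * \<phi> (Z \<omega>)) \<le> b powr (2 * H) * expectation (\<lambda>\<omega>. \<psi> (Z \<omega>))"
    using n by (intro LIMSEQ_le[OF lim\<phi> tendsto_mult_left[OF lim\<psi>]]) auto
qed

lemma stein_measure_Z: "stein_measure (distr M borel Z) (a powr (2 * H)) (b powr (2 * H))"
proof -
  interpret D: prob_space "distr M borel Z" by (rule prob_space_distr) measurable
  show ?thesis
  proof unfold_locales
    show "integrable (distr M borel Z) (\<lambda>z. z\<^sup>2)" using Z_sq by (simp add: integrable_distr_eq)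
    show "(LINT z|distr M borel Z. z) = 0"
      using integrable_Y by (simp add: integral_distr Z_def prob_space)
    fix \<phi> \<psi> :: "real \<Rightarrow> real"
    assume \<phi>: "\<And>x. (\<phi> has_real_derivative \<psi> x) (at x)" "\<phi> 0 = 0" and \<psi>c: "continuous_on UNIV \<psi>"
      and \<psi>: "\<And>x. 0 \<le> \<psi> x" "\<And>x. \<psi> x \<le> 1"
    have [measurable]: "\<psi> \<in> borel_measurable borel"
      by (rule borel_measurable_continuous_onI[OF \<psi>c])
    have "continuous_on UNIV \<phi>"
      using \<phi> by (intro continuous_at_imp_continuous_on ballI DERIV_isCont) auto
    then have [measurable]: "\<phi> \<in> borel_measurable borel"
      by (rule borel_measurable_continuous_onI)
    show "a powr (2 * H) * (LINT z|distr M borel Z. \<psi> z) \<le> (LINT z|distr M borel Z. z * \<phi> z) \<and>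
       (LINT z|distr M borel Z. z * \<phi> z) \<le> b powr (2 * H) * (LINT z|distr M borel Z. \<psi> z)"
      using Z_stein[OF \<phi> \<psi>c \<psi>] by (simp add: integral_distr)
  qed (use a ab in auto)
qed

end

theorem proposition1p2:
  fixes M :: "'a measure" and B :: "real \<Rightarrow> 'a \<Rightarrow> real" and H a b :: real
    and Z :: "'a \<Rightarrow> real"
  assumes "0 < a" and "a < b"
    and "1 / 2 < H" and "H < 1"
    and "fractional_brownian_motion M H B"
    and "Z = (\<lambda>\<omega>. (SUP t\<in>{a..b}. B t \<omega>) -
                   prob_space.expectation M (\<lambda>\<omega>'. SUP t\<in>{a..b}. B t \<omega>'))"
  shows "integrable M (\<lambda>\<omega>. SUP t\<in>{a..b}. B t \<omega>) \<and>
    (\<exists>\<rho> :: real \<Rightarrow> real.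
       (\<forall>z. 0 \<le> \<rho> z) \<and>
       distributed M lborel Z (\<lambda>z. ennreal (\<rho> z)) \<and>
       (AE z in lborel.
          prob_space.expectation M (\<lambda>\<omega>. \<bar>Z \<omega>\<bar>) / (2 * b powr (2 * H)) *
              exp (- (z\<^sup>2 / (2 * a powr (2 * H)))) \<le> \<rho> z \<and>
          \<rho> z \<le> prob_space.expectation M (\<lambda>\<omega>. \<bar>Z \<omega>\<bar>) / (2 * a powr (2 * H)) *
              exp (- (z\<^sup>2 / (2 * b powr (2 * H))))))"
proof -
  have "prob_space M"
    using assms(5) by (simp add: fractional_brownian_motion_def centered_gaussian_process_def gaussian_process_def)
  then interpret F: fbm_interval M B H a b
    using assms by (simp add: fbm_interval_def fbm_interval_axioms_def)
  have Y: "F.Y = (\<lambda>\<omega>. SUP t\<in>{a..b}. B t \<omega>)" by (simp add: F.Y_def fun_eq_iff)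
  have Z: "Z = F.Z" using assms(6) by (simp add: F.Z_def Y fun_eq_iff)
  interpret D: stein_measure "distr M borel F.Z" "a powr (2 * H)" "b powr (2 * H)"
    by (rule F.stein_measure_Z)
  have E: "(LINT x|distr M borel F.Z. \<bar>x\<bar>) = F.expectation (\<lambda>\<omega>. \<bar>Z \<omega>\<bar>)"
    unfolding Z by (subst integral_distr) auto
  obtain \<rho> where \<rho>: "\<rho> \<in> borel_measurable borel" "\<forall>x. 0 \<le> \<rho> x"
      "distr M borel F.Z = density lborel (\<lambda>x. ennreal (\<rho> x))"
      "AE z in lborel. F.expectation (\<lambda>\<omega>. \<bar>Z \<omega>\<bar>) / (2 * b powr (2 * H)) * exp (- (z\<^sup>2 / (2 * a powr (2 * H)))) \<le> \<rho> z \<and>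
       \<rho> z \<le> F.expectation (\<lambda>\<omega>. \<bar>Z \<omega>\<bar>) / (2 * a powr (2 * H)) * exp (- (z\<^sup>2 / (2 * b powr (2 * H))))"
    using D.density_gauss_bounds unfolding E by blast
  \<comment> \<open>\<open>distributed\<close> uses the law on \<open>lborel\<close>, the Stein
    argument the law on \<open>borel\<close>; the two have the same measurable sets.\<close>
  have "distr M lborel F.Z = distr M borel F.Z" by (rule distr_cong) auto
  then have "distributed M lborel Z (\<lambda>z. ennreal (\<rho> z))"
    using \<rho>(1,3) unfolding distributed_def Z by simp
  with \<rho>(2,4) F.integrable_Y show ?thesis unfolding Y by blast
qed

end
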